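(* Let $\mathcal{A}:\mathcal{S}^n\to\mathbb{R}^m$ be a linear map, represented by $A_1,\dots,A_m\in\mathcal{S}^n$ as $\mathcal{A}X=(A_1\bullet X,\dots,A_m\bullet X)^\top$. Then $\mathcal{A}\mathcal{S}^n_+=\{\mathcal{A}X: X\in\mathcal{S}^n_+\}$ is not closed if and only if $\mathcal{A}$ has a reformulation $\mathcal{A}'$, represented by $A_1',\dots,A_m'\in\mathcal{S}^n$, with the following properties: 1. $(A_1',\dots,A_{k+1}')$ is in semidefinite echelon form, for some $k\ge1$ (with $k+1\le m$); 2. There is a sequence $(X_1,\dots,X_{\ell+1})$ of matrices in $\mathcal{S}^n$ in semidefinite echelon form, where $\ell\ge 1$, such that $A_i'\bullet X_j=0$ for all $i=1,\dots,m$ and $j=1,\dots,\ell$; $A_i'\bullet X_{\ell+1}=0$ for $i=1,\dots,k$; and $A_{k+1}'\bullet X_{\ell+1}=-1$ (while $A_i'\bullet X_{\ell+1}$ is arbitrary for $i=k+2,\dots,m$).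
   Context: $\mathcal{S}^n$ is the space of real symmetric $n\times n$ matrices, $\mathcal{S}^n_+$ the cone of positive semidefinite ones, $A\bullet X=\operatorname{trace}(AX)$, $N=\{1,\dots,n\}$. For a matrix $M$ and $R,S\subseteq N$, $M(R,S)$ is the submatrix with rows in $R$ and columns in $S$, and $M(R)=M(R,R)$. Reformulation: a reformulation of the map $\mathcal{A}$ is any map $\mathcal{A}'$ whose representing matrices are obtained from $A_1,\dots,A_m$ by applying finitely many of the following operations, in any order: (1) exchange $A_i$ and $A_j$ for distinct $i,j$; (2) replace $A_i$ by $\lambda A_i+\mu A_j$, where $i\ne j$, $\lambda,\mu\in\mathbb{R}$, $\lambda\neq 0$; (3) replace all $A_i$ by $T^\top A_iT$, where $T$ is an invertible real $n\times n$ matrix. Semidefinite echelon form: a sequence $(M_1,\dots,M_k)$ of matrices in $\mathcal{S}^n$ is in semidefinite echelon form with structure $\{P_1,\dots,P_k\}$ if the $P_i$ are disjoint (possibly empty) subsets of $N$ and, for each $i=1,\dots,k$: $M_i(P_i)$ is diagonal with positive diagonal entries; $M_i(P_1\cup\dots\cup P_{i-1},N)$, and by symmetry its transpose, is arbitrary; and all remaining entries of $M_i$ are zero. A sequence is in semidefinite echelon form if it is so with some structure. *)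

theory Defs
  imports "HOL-Analysis.Analysis"
begin

text \<open>Order-n matrices are rendered as \<open>real^'n^'n\<close>; the index set N is
  \<open>UNIV :: 'n set\<close>. Finite sequences of matrices are lists, so indices start at 0.\<close>

definition sym_matrices :: "(real^'n^'n) set" where
  "sym_matrices = {X. transpose X = X}"

definition psd_cone :: "(real^'n^'n) set" where
  "psd_cone = {X \<in> sym_matrices. \<forall>v. 0 \<le> v \<bullet> (X *v v)}"

definition mat_inner :: "real^'n^'n \<Rightarrow> real^'n^'n \<Rightarrow> real"  (infixl "\<bullet>\<^sub>M" 70) where
  "A \<bullet>\<^sub>M X = trace (A ** X)"

text \<open>The linear map represented by a list of m symmetric matrices. Its codomain, m-dimensional
  real space, is the carrier of \<open>Euclidean_space m\<close>: the functions \<open>nat \<Rightarrow> real\<close> that vanish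
  at all indices \<open>i \<ge> m\<close>.\<close>

definition rep_map :: "(real^'n^'n) list \<Rightarrow> real^'n^'n \<Rightarrow> nat \<Rightarrow> real" where
  "rep_map As X = (\<lambda>i. if i < length As then As ! i \<bullet>\<^sub>M X else 0)"

inductive reformulation_step :: "(real^'n^'n) list \<Rightarrow> (real^'n^'n) list \<Rightarrow> bool" where
  exchange: "i < length As \<Longrightarrow> j < length As \<Longrightarrow> i \<noteq> j \<Longrightarrow>
     reformulation_step As (As[i := As ! j, j := As ! i])"
| combine: "i < length As \<Longrightarrow> j < length As \<Longrightarrow> i \<noteq> j \<Longrightarrow> c \<noteq> 0 \<Longrightarrow>
     reformulation_step As (As[i := c *\<^sub>R (As ! i) + d *\<^sub>R (As ! j)])"
| congruence: "invertible T \<Longrightarrow>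
     reformulation_step As (map (\<lambda>M. transpose T ** M ** T) As)"

definition reformulation :: "(real^'n^'n) list \<Rightarrow> (real^'n^'n) list \<Rightarrow> bool" where
  "reformulation As Bs \<longleftrightarrow> reformulation_step\<^sup>*\<^sup>* As Bs"

text \<open>In the last clause, \<open>Q\<close> is the union of the blocks before \<open>P ! i\<close>: a nonzero entry of
  \<open>Ms ! i\<close> has its row or its column in \<open>Q\<close>, or has both in \<open>P ! i\<close>.\<close>

definition sd_echelon_struct :: "(real^'n^'n) list \<Rightarrow> ('n set) list \<Rightarrow> bool" where
  "sd_echelon_struct Ms P \<longleftrightarrow>
     length P = length Ms \<and> set Ms \<subseteq> sym_matrices \<and>
     (\<forall>i < length P. \<forall>j < length P. i \<noteq> j \<longrightarrow> P ! i \<inter> P ! j = {}) \<and>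
     (\<forall>i < length Ms.
        (\<forall>a \<in> P ! i. Ms ! i $ a $ a > 0) \<and>
        (\<forall>a \<in> P ! i. \<forall>b \<in> P ! i. a \<noteq> b \<longrightarrow> Ms ! i $ a $ b = 0) \<and>
        (let Q = (\<Union>j<i. P ! j) in
         \<forall>a b. a \<notin> Q \<and> b \<notin> Q \<and> \<not> (a \<in> P ! i \<and> b \<in> P ! i) \<longrightarrow> Ms ! i $ a $ b = 0))"

definition sd_echelon :: "(real^'n^'n) list \<Rightarrow> bool" where
  "sd_echelon Ms \<longleftrightarrow> (\<exists>P. sd_echelon_struct Ms P)"

end

theory Submission
  imports Defs
begin

text \<open>Write \<open>K\<close> for the positive semidefinite cone plus the null space of \<open>\<A>\<close> in the symmetric
  matrices, the full preimage of the image cone; the image is closed iff \<open>K\<close> is, and reformulations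
  preserve this. Both echelon conditions are coordinate forms of one notion: a sequence of forms, each
  semidefinite on the subspace on which all earlier ones vanish (\<open>regular\<close>, \<open>flag\<close>). A point
  \<open>X0\<close> in the closure of \<open>K\<close> but not in \<open>K\<close> yields two such sequences by facial reduction: one in
  the span of the \<open>A\<^sub>i\<close>, ending in a form with value \<open>-1\<close> at \<open>X0\<close>, which shows that
  \<open>X0 \<notin> K\<close>; and one in the null space, ending in a point of \<open>X0\<close> plus the null space, which by
  Finsler's lemma shows that \<open>X0\<close> is in the closure.

  The two sequences live on dual spaces, and one basis puts both in echelon form: dual basis vectors
  are chosen pair by pair, each pair being a largest singular pair for the pairing of the deepest two
  flag members that still pair nontrivially.\<close>

section \<open>Bilinear forms and regular sequences\<close>

text \<open>A functional that is nonnegative on \<open>K\<close> is nonnegative on its closure, so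
  no single form separates \<open>X0\<close> from \<open>K\<close> strictly. Proper separation still
  gives a form in the span that is nonnegative on the current subspace and has value 0 at
  \<open>X0\<close> without vanishing on that subspace. Passing to its kernel lowers the dimension,
  until a negative value occurs. That the negative form is never the first one is the condition
  \<open>k \<ge> 1\<close>.

  The obstacle is the common basis. A congruence by \<open>T\<close> on the \<open>A\<^sub>i\<close>
  must be matched by the inverse congruence on the \<open>X\<^sub>j\<close>, so the two sequences
  cannot be diagonalised independently. Some basis is always compatible with two flags, but this
  gives only the zero pattern; diagonal blocks also need the vectors of one level to be orthogonal
  for the form of that level, in both spaces at once. Singular pairs provide this because they are
  stationary for both forms simultaneously.\<close>

abbreviation bform :: "real^'n^'n \<Rightarrow> real^'n \<Rightarrow> real^'n \<Rightarrow> real" where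
  "bform M u v \<equiv> u \<bullet> (M *v v)"

lemma bform_entries: "bform M u v = (\<Sum>a\<in>UNIV. \<Sum>b\<in>UNIV. M $ a $ b * u $ a * v $ b)"
  by (simp add: inner_vec_def matrix_vector_mult_def sum_distrib_left mult_ac)

lemma bform_axis: "bform M (axis a 1) (axis b 1) = M $ a $ b"
  by (simp add: matrix_vector_mul_component inner_axis inner_axis')

lemma bform_commute:
  assumes "M \<in> sym_matrices"
  shows "bform M u v = bform M v u"
  using assms unfolding sym_matrices_def
  by (metis (mono_tags, lifting) dot_lmul_matrix inner_commute mem_Collect_eq vector_transpose_matrix)

lemma bform_add_left: "bform M (u + v) w = bform M u w + bform M v w"
  by (simp add: inner_left_distrib)

lemma bform_add_right: "bform M u (v + w) = bform M u v + bform M u w"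
  by (simp add: inner_right_distrib matrix_vector_right_distrib)

lemma bform_scaleR_left: "bform M (c *\<^sub>R u) v = c * bform M u v"
  by simp

lemma bform_scaleR_right: "bform M u (c *\<^sub>R v) = c * bform M u v"
  by (simp add: matrix_vector_mult_scaleR)

lemma bform_perturb:
  assumes "M \<in> sym_matrices"
  shows "bform M (u + t *\<^sub>R v) (u + t *\<^sub>R v) = bform M u u + 2 * t * bform M u v + t\<^sup>2 * bform M v v"
  using bform_commute[OF assms, of u v]
  by (simp add: bform_add_left bform_add_right bform_scaleR_left bform_scaleR_right
      power2_eq_square algebra_simps del: inner_scaleR_left)

lemma bform_transform:
  fixes T :: "real^'n^'n"
  shows "bform (transpose T ** M ** T) u v = bform M (T *v u) (T *v v)"
proof -
  have "bform (transpose T ** M ** T) u v = u \<bullet> (transpose T *v (M *v (T *v v)))"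
    by (simp only: matrix_vector_mul_assoc matrix_mul_assoc)
  also have "\<dots> = u \<bullet> ((M *v (T *v v)) v* T)" by simp
  also have "\<dots> = bform M (T *v u) (T *v v)"
    by (metis dot_lmul_matrix inner_commute)
  finally show ?thesis .
qed

lemma sym_matrices_iff: "M \<in> sym_matrices \<longleftrightarrow> (\<forall>a b. M $ a $ b = M $ b $ a)"
  by (auto simp: sym_matrices_def transpose_def vec_eq_iff)

lemma subspace_sym_matrices: "subspace sym_matrices"
  by (auto simp: subspace_def sym_matrices_iff)

lemma sym_matrices_transform:
  "M \<in> sym_matrices \<Longrightarrow> transpose T ** M ** T \<in> sym_matrices"
  by (simp add: sym_matrices_def matrix_transpose_mul matrix_mul_assoc)

lemma mat_1_sym: "mat 1 \<in> sym_matrices"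
  by (simp add: sym_matrices_def)

text \<open>The first-order condition behind \<open>bform_kernel\<close> and
  \<open>critical_pair\<close>: along a line through a minimum the increment has this shape, so the
  derivative \<open>b\<close> must vanish.\<close>

lemma linear_term_zero:
  fixes b c :: real
  assumes "\<And>t. 0 \<le> 2 * t * b + t\<^sup>2 * c"
  shows "b = 0"
proof (rule ccontr)
  assume "b \<noteq> 0"
  define d where "d = \<bar>c\<bar> + 1"
  have "d > 0" "c < d" by (auto simp: d_def)
  have "0 \<le> 2 * (- b / d) * b + (- b / d)\<^sup>2 * c" by (rule assms)
  also have "\<dots> \<le> 2 * (- b / d) * b + (- b / d)\<^sup>2 * d"
    using \<open>c < d\<close> by (intro add_left_mono mult_left_mono) auto
  also have "\<dots> = - b\<^sup>2 / d"
    using \<open>d > 0\<close> by (simp add: field_simps power2_eq_square)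
  also have "\<dots> < 0" using \<open>b \<noteq> 0\<close> \<open>d > 0\<close> by simp
  finally show False by simp
qed

text \<open>A zero of a form that is nonnegative on \<open>V\<close> is a minimum, so the derivative
  there vanishes in every direction of \<open>V\<close>. Hence the isotropic vectors are the radical
  of the restricted form, and so a subspace.\<close>

lemma bform_kernel:
  assumes "M \<in> sym_matrices" "subspace V" "\<And>v. v \<in> V \<Longrightarrow> 0 \<le> bform M v v"
    and "u \<in> V" "bform M u u = 0" "v \<in> V"
  shows "bform M u v = 0"
proof -
  have "0 \<le> bform M (v + s *\<^sub>R u) (v + s *\<^sub>R u)" for s
    using assms by (simp add: subspace_add subspace_scale)
  moreover have "0 \<le> 2 * t * bform M u v + t\<^sup>2 * bform M v v" for t
  proof -
    have "u + t *\<^sub>R v \<in> V" using assms by (simp add: subspace_add subspace_scale)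
    then show ?thesis using assms(3)[of "u + t *\<^sub>R v"] bform_perturb[OF assms(1), of u t v] assms(5) by simp
  qed
  ultimately show ?thesis by (rule_tac linear_term_zero)
qed

lemma subspace_bform_kernel:
  assumes "M \<in> sym_matrices" "subspace V" "\<And>v. v \<in> V \<Longrightarrow> 0 \<le> bform M v v"
  shows "subspace {v \<in> V. bform M v v = 0}"
  unfolding subspace_def
proof (intro conjI ballI allI)
  show "0 \<in> {v \<in> V. bform M v v = 0}" using subspace_0[OF assms(2)] by simp
next
  fix x y assume "x \<in> {v \<in> V. bform M v v = 0}" "y \<in> {v \<in> V. bform M v v = 0}"
  then show "x + y \<in> {v \<in> V. bform M v v = 0}"
    using bform_kernel[OF assms, of x y] bform_commute[OF assms(1), of x y] assms(2)
    by (simp add: bform_add_left bform_add_right subspace_add)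
next
  fix c x assume "x \<in> {v \<in> V. bform M v v = 0}"
  then show "c *\<^sub>R x \<in> {v \<in> V. bform M v v = 0}"
    using assms(2) by (simp add: matrix_vector_mult_scaleR subspace_scale)
qed

section \<open>Flags and regular sequences\<close>

definition flag :: "(real^'n^'n) list \<Rightarrow> nat \<Rightarrow> (real^'n) set" where
  "flag Ms i = {v. \<forall>j<i. bform (Ms ! j) v v = 0}"

text \<open>This makes each \<open>flag\<close> member the radical of a semidefinite form on the
  previous one, hence a subspace, although \<open>flag\<close> is defined by quadratic equations. In
  terms of the cone it encodes a face: for \<open>i \<le> length Ms\<close>, a sum of matrices
  \<open>outer u\<close> is annihilated by the first \<open>i\<close> forms exactly when every
  \<open>u\<close> lies in \<open>flag Ms i\<close>.\<close>

definition regular :: "(real^'n^'n) list \<Rightarrow> bool" where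
  "regular Ms \<longleftrightarrow> set Ms \<subseteq> sym_matrices \<and>
     (\<forall>i<length Ms. \<forall>v\<in>flag Ms i. 0 \<le> bform (Ms ! i) v v)"

lemma flag_0 [simp]: "flag Ms 0 = UNIV"
  by (simp add: flag_def)

lemma flag_Suc: "flag Ms (Suc i) = {v \<in> flag Ms i. bform (Ms ! i) v v = 0}"
  by (auto simp: flag_def less_Suc_eq)

lemma flag_antimono: "i \<le> j \<Longrightarrow> flag Ms j \<subseteq> flag Ms i"
  by (auto simp: flag_def)

lemma flag_append: "i \<le> length Ms \<Longrightarrow> flag (Ms @ Ns) i = flag Ms i"
  by (auto simp: flag_def nth_append)

lemma regular_sym: "regular Ms \<Longrightarrow> i < length Ms \<Longrightarrow> Ms ! i \<in> sym_matrices"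
  by (auto simp: regular_def)

lemma regularD: "regular Ms \<Longrightarrow> i < length Ms \<Longrightarrow> v \<in> flag Ms i \<Longrightarrow> 0 \<le> bform (Ms ! i) v v"
  by (auto simp: regular_def)

lemma regular_snoc:
  "regular (Ms @ [M]) \<longleftrightarrow>
     regular Ms \<and> M \<in> sym_matrices \<and> (\<forall>v\<in>flag Ms (length Ms). 0 \<le> bform M v v)"
  by (auto simp: regular_def nth_append flag_append less_Suc_eq)

lemma subspace_flag:
  assumes "regular Ms" "i \<le> length Ms"
  shows "subspace (flag Ms i)"
  using assms(2)
proof (induction i)
  case (Suc i)
  then show ?case
    using subspace_bform_kernel[of "Ms ! i" "flag Ms i"] regular_sym[OF assms(1)] regularD[OF assms(1)]
    by (simp add: flag_Suc)
qed simp

lemma flag_kernel: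
  assumes "regular Ms" "i < length Ms" "u \<in> flag Ms (Suc i)" "v \<in> flag Ms i"
  shows "bform (Ms ! i) u v = 0"
  using assms bform_kernel[OF regular_sym[OF assms(1,2)] subspace_flag[OF assms(1)], of i u v]
    regularD[OF assms(1)]
  by (simp add: flag_Suc)

text \<open>\<open>E'\<close> is the orthogonal complement of the kernel inside \<open>E\<close> and
  stands for the quotient by the kernel: the form is definite on it, and as a subspace it has a
  compact unit sphere.\<close>

lemma complement_of_kernel:
  assumes M: "M \<in> sym_matrices" and E: "subspace E" and psd: "\<And>v. v \<in> E \<Longrightarrow> 0 \<le> bform M v v"
  obtains E' where "subspace E'" "E' \<subseteq> E" "\<And>w. w \<in> E' \<Longrightarrow> w \<noteq> 0 \<Longrightarrow> 0 < bform M w w"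
    and "\<And>u. u \<in> E \<Longrightarrow> \<exists>w\<in>E'. bform M w w = bform M u u \<and> u - w \<in> E \<and> bform M (u - w) (u - w) = 0"
proof -
  define Z where "Z = {z \<in> E. bform M z z = 0}"
  have Z: "subspace Z"
    unfolding Z_def by (rule subspace_bform_kernel[OF M E psd])
  define E' where "E' = {w \<in> E. \<forall>z\<in>Z. orthogonal z w}"
  show ?thesis
  proof
    show "subspace E'"
      using E by (auto simp: E'_def subspace_def orthogonal_def inner_right_distrib)
    show "E' \<subseteq> E" by (auto simp: E'_def)
  next
    fix w assume w: "w \<in> E'" "w \<noteq> 0"
    then have "bform M w w \<noteq> 0"
      by (auto simp: E'_def Z_def orthogonal_def)
    then show "0 < bform M w w" using psd[of w] w by (auto simp: E'_def)
  next
    fix u assume u: "u \<in> E"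
    obtain y z where yz: "y \<in> span Z" "\<And>w. w \<in> span Z \<Longrightarrow> orthogonal z w" "u = y + z"
      using orthogonal_subspace_decomp_exists[of Z u] by metis
    have "y \<in> Z" using yz(1) Z span_eq_iff by blast
    then have y: "y \<in> E" "bform M y y = 0" by (auto simp: Z_def)
    have "z = u - y" using yz(3) by simp
    then have zE: "z \<in> E" using u y(1) E by (simp add: subspace_diff)
    then have "z \<in> E'" using yz(2) by (auto simp: E'_def span_base orthogonal_commute)
    moreover have "bform M z z = bform M u u"
    proof -
      have "bform M y z = 0" using bform_kernel[OF M E psd] y zE by blast
      then show ?thesis
        using y(2) bform_perturb[OF M, of y 1 z] yz(3) by simp
    qed
    ultimately show "\<exists>w\<in>E'. bform M w w = bform M u u \<and> u - w \<in> E \<and> bform M (u - w) (u - w) = 0"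
      using y yz(3) by (intro bexI[of _ z]) auto
  qed
qed

text \<open>The pair maximises \<open>(e \<bullet> f)\<^sup>2 / (bform M e e * bform N f f)\<close>, as for the largest
  singular value; the conclusion is stationarity.\<close>

lemma critical_pair:
  fixes M N :: "real^'n^'n"
  assumes M: "M \<in> sym_matrices" and E: "subspace E" and Mpsd: "\<And>v. v \<in> E \<Longrightarrow> 0 \<le> bform M v v"
    and N: "N \<in> sym_matrices" and F: "subspace F" and Npsd: "\<And>v. v \<in> F \<Longrightarrow> 0 \<le> bform N v v"
    and Mker: "\<And>z f. z \<in> E \<Longrightarrow> bform M z z = 0 \<Longrightarrow> f \<in> F \<Longrightarrow> z \<bullet> f = 0"
    and Nker: "\<And>z e. z \<in> F \<Longrightarrow> bform N z z = 0 \<Longrightarrow> e \<in> E \<Longrightarrow> e \<bullet> z = 0"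
    and e0: "e0 \<in> E" and f0: "f0 \<in> F" and ef0: "e0 \<bullet> f0 \<noteq> 0"
  obtains e f where "e \<in> E" "f \<in> F" "e \<bullet> f \<noteq> 0"
    "\<And>x. x \<in> E \<Longrightarrow> x \<bullet> f = 0 \<Longrightarrow> bform M e x = 0"
    "\<And>y. y \<in> F \<Longrightarrow> e \<bullet> y = 0 \<Longrightarrow> bform N f y = 0"
proof -
  obtain E' where E': "subspace E'" "E' \<subseteq> E" "\<And>w. w \<in> E' \<Longrightarrow> w \<noteq> 0 \<Longrightarrow> 0 < bform M w w"
    and E'rep: "\<And>u. u \<in> E \<Longrightarrow> \<exists>w\<in>E'. bform M w w = bform M u u \<and> u - w \<in> E \<and> bform M (u - w) (u - w) = 0"
    using complement_of_kernel[OF M E Mpsd] by blast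
  obtain F' where F': "subspace F'" "F' \<subseteq> F" "\<And>w. w \<in> F' \<Longrightarrow> w \<noteq> 0 \<Longrightarrow> 0 < bform N w w"
    and F'rep: "\<And>u. u \<in> F \<Longrightarrow> \<exists>w\<in>F'. bform N w w = bform N u u \<and> u - w \<in> F \<and> bform N (u - w) (u - w) = 0"
    using complement_of_kernel[OF N F Npsd] by blast
  \<comment> \<open>Kernel vectors pair to zero with the other space, so reducing to
    \<open>E'\<close> changes neither the form nor the pairing.\<close>
  have E'rep': "\<exists>w\<in>E'. bform M w w = bform M u u \<and> (\<forall>f\<in>F. w \<bullet> f = u \<bullet> f)" if u: "u \<in> E" for u
  proof -
    obtain w where w: "w \<in> E'" "bform M w w = bform M u u" "u - w \<in> E" "bform M (u - w) (u - w) = 0"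
      using E'rep[OF u] by blast
    have "w \<bullet> f = u \<bullet> f" if "f \<in> F" for f
      using Mker[OF w(3,4) that] by (simp add: inner_diff_left)
    with w show ?thesis by blast
  qed
  have F'rep': "\<exists>w\<in>F'. bform N w w = bform N u u \<and> (\<forall>e\<in>E. e \<bullet> w = e \<bullet> u)" if u: "u \<in> F" for u
  proof -
    obtain w where w: "w \<in> F'" "bform N w w = bform N u u" "u - w \<in> F" "bform N (u - w) (u - w) = 0"
      using F'rep[OF u] by blast
    have "e \<bullet> w = e \<bullet> u" if "e \<in> E" for e
      using Nker[OF w(3,4) that] by (simp add: inner_diff_right)
    with w show ?thesis by blast
  qed
  obtain e1 where e1: "e1 \<in> E'" "e1 \<bullet> f0 \<noteq> 0" using E'rep'[OF e0] f0 ef0 by metis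
  obtain f1 where f1: "f1 \<in> F'" "e1 \<bullet> f1 \<noteq> 0" using F'rep'[OF f0] e1 E'(2) by (metis subsetD)
  define SE where "SE = E' \<inter> sphere 0 1"
  define SF where "SF = F' \<inter> sphere 0 1"
  define h where "h = (\<lambda>(u, w). (u \<bullet> w)\<^sup>2 / (bform M u u * bform N w w))"
  have SE_nz: "u \<noteq> 0" if "u \<in> SE" for u using that by (auto simp: SE_def)
  have SE: "compact SE" "\<And>u. u \<in> SE \<Longrightarrow> 0 < bform M u u"
    using E' SE_nz by (auto simp: SE_def intro!: closed_Int_compact closed_subspace)
  have SF_nz: "u \<noteq> 0" if "u \<in> SF" for u using that by (auto simp: SF_def)
  have SF: "compact SF" "\<And>u. u \<in> SF \<Longrightarrow> 0 < bform N u u"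
    using F' SF_nz by (auto simp: SF_def intro!: closed_Int_compact closed_subspace)
  have nz1: "e1 \<noteq> 0" "f1 \<noteq> 0" using f1(2) by auto
  define e2 where "e2 = (1 / norm e1) *\<^sub>R e1"
  define f2 where "f2 = (1 / norm f1) *\<^sub>R f1"
  have 2: "e2 \<in> SE" "f2 \<in> SF" "e2 \<bullet> f2 \<noteq> 0"
    using e1 f1 nz1 E'(1) F'(1) by (auto simp: SE_def SF_def e2_def f2_def subspace_scale)
  have "\<exists>p\<in>SE \<times> SF. \<forall>q\<in>SE \<times> SF. h q \<le> h p"
  proof (rule continuous_attains_sup)
    show "compact (SE \<times> SF)" using SE SF by (intro compact_Times)
    show "SE \<times> SF \<noteq> {}" using 2 by auto
    show "continuous_on (SE \<times> SF) h"
      unfolding h_def split_def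
      by (intro continuous_intros continuous_on_compose2[OF matrix_vector_mult_linear_continuous_on[of UNIV]])
         (use SE(2) SF(2) in \<open>fastforce+\<close>)
  qed
  then obtain e f where ef: "e \<in> SE" "f \<in> SF" "\<And>u w. u \<in> SE \<Longrightarrow> w \<in> SF \<Longrightarrow> h (u, w) \<le> h (e, f)"
    by auto
  define r where "r = h (e, f)"
  have "0 < h (e2, f2)" using 2 SE(2)[of e2] SF(2)[of f2] by (simp add: h_def)
  then have r: "0 < r" using ef(3)[OF 2(1,2)] by (simp add: r_def)
  have eq: "(e \<bullet> f)\<^sup>2 = r * (bform M e e * bform N f f)"
    using SE(2)[OF ef(1)] SF(2)[OF ef(2)] by (simp add: r_def h_def)
  \<comment> \<open>The maximum on the unit spheres extends by homogeneity to \<open>E'\<close> and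
    \<open>F'\<close>, and from there to \<open>E\<close> and \<open>F\<close>, since replacing a
    vector by its representative changes neither side.\<close>
  have bound: "(u \<bullet> w)\<^sup>2 \<le> r * (bform M u u * bform N w w)" if u: "u \<in> E" and w: "w \<in> F" for u w
  proof -
    obtain u' where u': "u' \<in> E'" "bform M u' u' = bform M u u" "u' \<bullet> w = u \<bullet> w"
      using E'rep'[OF u] w by blast
    obtain w' where w': "w' \<in> F'" "bform N w' w' = bform N w w" "u' \<bullet> w' = u' \<bullet> w"
      using F'rep'[OF w] u' E'(2) by blast
    have "(u' \<bullet> w')\<^sup>2 \<le> r * (bform M u' u' * bform N w' w')"
    proof (cases "u' = 0 \<or> w' = 0")
      case False
      define u2 where "u2 = (1 / norm u') *\<^sub>R u'"
      define w2 where "w2 = (1 / norm w') *\<^sub>R w'"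
      have in2: "u2 \<in> SE" "w2 \<in> SF"
        using u' w' False E'(1) F'(1) by (auto simp: SE_def SF_def u2_def w2_def subspace_scale)
      have "h (u2, w2) \<le> r" using ef(3)[OF in2] by (simp add: r_def)
      then have "(u2 \<bullet> w2)\<^sup>2 \<le> r * (bform M u2 u2 * bform N w2 w2)"
        using SE(2)[OF in2(1)] SF(2)[OF in2(2)] by (simp add: h_def pos_divide_le_eq)
      then have "(norm u')\<^sup>2 * (norm w')\<^sup>2 * (u2 \<bullet> w2)\<^sup>2 \<le>
          (norm u')\<^sup>2 * (norm w')\<^sup>2 * (r * (bform M u2 u2 * bform N w2 w2))"
        by (intro mult_left_mono) auto
      moreover have "(norm u')\<^sup>2 * (norm w')\<^sup>2 * (u2 \<bullet> w2)\<^sup>2 = (u' \<bullet> w')\<^sup>2"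
        using False by (simp add: u2_def w2_def field_simps)
      moreover have "(norm u')\<^sup>2 * (norm w')\<^sup>2 * (r * (bform M u2 u2 * bform N w2 w2)) =
          r * (bform M u' u' * bform N w' w')"
        using False by (simp add: u2_def w2_def matrix_vector_mult_scaleR power2_eq_square field_simps)
      ultimately show ?thesis by simp
    qed auto
    then show ?thesis using u' w' by simp
  qed
  have inEF: "e \<in> E" "f \<in> F" using ef E'(2) F'(2) by (auto simp: SE_def SF_def)
  have pos: "0 < bform M e e" "0 < bform N f f" using ef SE(2) SF(2) by auto
  show ?thesis
  proof (rule that[OF inEF])
    show "e \<bullet> f \<noteq> 0" using eq r pos by auto
  next
    fix x assume x: "x \<in> E" "x \<bullet> f = 0"
    \<comment> \<open>Adding multiples of \<open>x\<close> does not change the pairing with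
      \<open>f\<close>, and \<open>bound\<close> is an equality at \<open>e\<close> and
      \<open>f\<close>; so \<open>e\<close> minimises the form of \<open>M\<close> along this
      line.\<close>
    have "0 \<le> 2 * t * bform M e x + t\<^sup>2 * bform M x x" for t
    proof -
      have "e + t *\<^sub>R x \<in> E" using x inEF E by (simp add: subspace_add subspace_scale)
      then have "r * (bform M e e * bform N f f) \<le> r * (bform M (e + t *\<^sub>R x) (e + t *\<^sub>R x) * bform N f f)"
        using bound[of "e + t *\<^sub>R x" f] eq x inEF by (simp add: inner_left_distrib)
      then have "bform M e e \<le> bform M (e + t *\<^sub>R x) (e + t *\<^sub>R x)" using r pos by simp
      then show ?thesis using bform_perturb[OF M, of e t x] by simp
    qed
    then show "bform M e x = 0" by (rule linear_term_zero)
  next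
    fix y assume y: "y \<in> F" "e \<bullet> y = 0"
    have "0 \<le> 2 * t * bform N f y + t\<^sup>2 * bform N y y" for t
    proof -
      have "f + t *\<^sub>R y \<in> F" using y inEF F by (simp add: subspace_add subspace_scale)
      then have "r * (bform M e e * bform N f f) \<le> r * (bform M e e * bform N (f + t *\<^sub>R y) (f + t *\<^sub>R y))"
        using bound[of e "f + t *\<^sub>R y"] eq y inEF by (simp add: inner_right_distrib)
      then have "bform N f f \<le> bform N (f + t *\<^sub>R y) (f + t *\<^sub>R y)" using r pos by simp
      then show ?thesis using bform_perturb[OF N, of f t y] by simp
    qed
    then show "bform N f y = 0" by (rule linear_term_zero)
  qed
qed

section \<open>Simultaneous echelon forms\<close>

definition biorthogonal :: "nat \<Rightarrow> (nat \<Rightarrow> real^'n) \<Rightarrow> (nat \<Rightarrow> real^'n) \<Rightarrow> bool" where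
  "biorthogonal r e f \<longleftrightarrow> (\<forall>s<r. \<forall>t<r. e s \<bullet> f t = (if s = t then 1 else 0))"

text \<open>The last clause says that every vector still available after step \<open>s\<close> (orthogonal to
  \<open>f 0, \<dots>, f s\<close>) is orthogonal to \<open>e s\<close> for the form of its level.\<close>

definition adapted ::
  "(real^'n^'n) list \<Rightarrow> nat \<Rightarrow> (nat \<Rightarrow> real^'n) \<Rightarrow> (nat \<Rightarrow> real^'n) \<Rightarrow> (nat \<Rightarrow> nat) \<Rightarrow> bool" where
  "adapted Ms r e f \<alpha> \<longleftrightarrow> (\<forall>s<r. \<alpha> s < length Ms \<and> e s \<in> flag Ms (\<alpha> s) \<and>
     0 < bform (Ms ! \<alpha> s) (e s) (e s) \<and>
     (\<forall>x\<in>flag Ms (\<alpha> s). (\<forall>t\<le>s. x \<bullet> f t = 0) \<longrightarrow> bform (Ms ! \<alpha> s) (e s) x = 0))"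

lemma biorthogonal_commute: "biorthogonal r e f \<Longrightarrow> biorthogonal r f e"
  by (auto simp: biorthogonal_def inner_commute)

lemma adapted_Suc:
  assumes "adapted Ms r e f \<alpha>" "i < length Ms" "x \<in> flag Ms i" "0 < bform (Ms ! i) x x"
    "\<And>y. y \<in> flag Ms i \<Longrightarrow> (\<And>t. t < r \<Longrightarrow> y \<bullet> f t = 0) \<Longrightarrow> y \<bullet> z = 0 \<Longrightarrow> bform (Ms ! i) x y = 0"
  shows "adapted Ms (Suc r) (e(r := x)) (f(r := z)) (\<alpha>(r := i))"
  unfolding adapted_def
proof (intro allI impI)
  fix s assume "s < Suc r"
  then consider "s < r" | "s = r" by linarith
  then show "(\<alpha>(r := i)) s < length Ms \<and>
         (e(r := x)) s \<in> flag Ms ((\<alpha>(r := i)) s) \<and>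
         0 < bform (Ms ! (\<alpha>(r := i)) s) ((e(r := x)) s) ((e(r := x)) s) \<and>
         (\<forall>y\<in>flag Ms ((\<alpha>(r := i)) s). (\<forall>t\<le>s. y \<bullet> (f(r := z)) t = 0) \<longrightarrow>
             bform (Ms ! (\<alpha>(r := i)) s) ((e(r := x)) s) y = 0)"
  proof cases
    case 1
    then have "(f(r := z)) t = f t" if "t \<le> s" for t using that by auto
    with 1 assms(1) show ?thesis by (simp add: adapted_def)
  next
    case 2
    have "bform (Ms ! i) x y = 0" if "y \<in> flag Ms i" "\<forall>t\<le>r. y \<bullet> (f(r := z)) t = 0" for y
    proof (rule assms(5)[OF that(1)])
      show "y \<bullet> f t = 0" if "t < r" for t
        using \<open>\<forall>t\<le>r. y \<bullet> (f(r := z)) t = 0\<close>[rule_format, of t] that by simp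
      show "y \<bullet> z = 0" using that(2)[rule_format, of r] by simp
    qed
    with 2 assms show ?thesis by simp
  qed
qed

text \<open>By biorthogonality, the later of two vectors on one level is still available after the
  earlier one was chosen, so the last clause of \<open>adapted\<close> applies to it; symmetry of
  the form covers the other order.\<close>

lemma adapted_orthogonal:
  assumes reg: "regular Ms" and bi: "biorthogonal r e f" and ad: "adapted Ms r e f \<alpha>"
    and st: "s < r" "t < r" "s \<noteq> t" "\<alpha> s = \<alpha> t"
  shows "bform (Ms ! \<alpha> s) (e s) (e t) = 0"
proof -
  have "bform (Ms ! \<alpha> s) (e s) (e t) = 0" if "s < t" "t < r" "\<alpha> s = \<alpha> t" for s t
  proof -
    have "e t \<in> flag Ms (\<alpha> s)" using ad that by (auto simp: adapted_def)
    moreover have "\<forall>u\<le>s. e t \<bullet> f u = 0" using bi that by (auto simp: biorthogonal_def)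
    ultimately show ?thesis using ad that unfolding adapted_def by (meson less_trans)
  qed
  moreover have "bform (Ms ! \<alpha> s) (e s) (e t) = bform (Ms ! \<alpha> s) (e t) (e s)"
    using ad st by (intro bform_commute regular_sym[OF reg]) (auto simp: adapted_def)
  ultimately show ?thesis using st by (metis nat_neq_iff)
qed

text \<open>Induction on the number of chosen pairs. \<open>E i\<close> and \<open>F j\<close> hold
  the flag vectors orthogonal to all earlier partners. For levels with \<open>i + j\<close> maximal
  among those that pair nontrivially, the kernel of \<open>Ms ! i\<close> in \<open>E i\<close> is
  \<open>E (Suc i)\<close> and therefore annihilates \<open>F j\<close>, and symmetrically; these
  are the kernel hypotheses of \<open>critical_pair\<close>.\<close>

lemma ex_adapted_biorthogonal:
  fixes Ms Xs :: "(real^'n^'n) list"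
  assumes Ms: "regular Ms" "flag Ms (length Ms) \<subseteq> {0}"
    and Xs: "regular Xs" "flag Xs (length Xs) \<subseteq> {0}"
    and "r \<le> CARD('n)"
  shows "\<exists>e f \<alpha> \<beta>. biorthogonal r e f \<and> adapted Ms r e f \<alpha> \<and> adapted Xs r f e \<beta>"
  using assms(5)
proof (induction r)
  case 0
  show ?case by (simp add: biorthogonal_def adapted_def)
next
  case (Suc r)
  then obtain e f \<alpha> \<beta> where bi: "biorthogonal r e f"
    and adM: "adapted Ms r e f \<alpha>" and adX: "adapted Xs r f e \<beta>" by auto
  define E where "E i = {x \<in> flag Ms i. \<forall>t<r. x \<bullet> f t = 0}" for i
  define F where "F j = {y \<in> flag Xs j. \<forall>t<r. y \<bullet> e t = 0}" for j
  have E: "subspace (E i)" if "i \<le> length Ms" for i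
    using subspace_flag[OF Ms(1) that] by (auto simp: E_def subspace_def inner_left_distrib)
  have F: "subspace (F j)" if "j \<le> length Xs" for j
    using subspace_flag[OF Xs(1) that] by (auto simp: F_def subspace_def inner_left_distrib)
  define paired where "paired p \<longleftrightarrow> fst p \<le> length Ms \<and> snd p \<le> length Xs \<and>
    (\<exists>x\<in>E (fst p). \<exists>y\<in>F (snd p). x \<bullet> y \<noteq> 0)" for p
  \<comment> \<open>\<open>x\<close> is orthogonal to all \<open>f t\<close>, which is possible as
    long as fewer pairs than the dimension are chosen. Subtracting a combination of the
    \<open>f s\<close> makes \<open>y\<close> orthogonal to all \<open>e t\<close> and leaves
    \<open>x \<bullet> y = x \<bullet> x\<close>.\<close>
  have "paired (0, 0)"
  proof -
    have "dim (f ` {..<r}) \<le> card (f ` {..<r})" by (simp add: dim_le_card')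
    also have "\<dots> \<le> r" using card_image_le[of "{..<r}" f] by simp
    also have "\<dots> < DIM(real^'n)" using Suc.prems by simp
    finally obtain x where x: "x \<noteq> 0" "\<And>y. y \<in> span (f ` {..<r}) \<Longrightarrow> orthogonal x y"
      using orthogonal_to_subspace_exists by metis
    have xf: "x \<bullet> f t = 0" if "t < r" for t
      using x(2)[of "f t"] that by (auto simp: orthogonal_def span_base)
    define y where "y = x - (\<Sum>s<r. (x \<bullet> e s) *\<^sub>R f s)"
    have "y \<bullet> e t = 0" if "t < r" for t
    proof -
      have "(\<Sum>s<r. (x \<bullet> e s) * (f s \<bullet> e t)) = (\<Sum>s<r. if s = t then x \<bullet> e s else 0)"
        using bi that by (intro sum.cong) (auto simp: biorthogonal_def inner_commute)
      then show ?thesis using that by (simp add: y_def inner_diff_left inner_sum_left)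
    qed
    moreover have "x \<bullet> y = x \<bullet> x"
      using xf by (simp add: y_def inner_diff_right inner_sum_right)
    ultimately show ?thesis
      using x(1) xf unfolding paired_def E_def F_def
      by (simp, intro exI[of _ x] conjI exI[of _ y]) auto
  qed
  moreover have "\<forall>p. paired p \<longrightarrow> fst p + snd p < length Ms + length Xs + 1"
    by (auto simp: paired_def)
  ultimately obtain p where p: "paired p" "\<And>q. paired q \<Longrightarrow> fst q + snd q \<le> fst p + snd p"
    using Lattices_Big.ex_has_greatest_nat[of paired "(0, 0)" "\<lambda>p. fst p + snd p"] by blast
  obtain i j where ij: "p = (i, j)" by (cases p)
  have le: "i \<le> length Ms" "j \<le> length Xs" using p(1) ij by (auto simp: paired_def)
  obtain x0 y0 where xy0: "x0 \<in> E i" "y0 \<in> F j" "x0 \<bullet> y0 \<noteq> 0"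
    using p(1) ij by (auto simp: paired_def)
  \<comment> \<open>The last flag members are zero and pair with nothing, so both levels still have
    a form.\<close>
  have "i \<noteq> length Ms" "j \<noteq> length Xs"
    using xy0 Ms(2) Xs(2) by (auto simp: E_def F_def)
  then have lt: "i < length Ms" "j < length Xs" using le by auto
  have kerM: "x \<bullet> y = 0" if "x \<in> E i" "bform (Ms ! i) x x = 0" "y \<in> F j" for x y
  proof -
    have "x \<in> E (Suc i)" using that by (auto simp: E_def flag_Suc)
    then show ?thesis using p(2)[of "(Suc i, j)"] that ij lt by (auto simp: paired_def)
  qed
  have kerX: "x \<bullet> y = 0" if "y \<in> F j" "bform (Xs ! j) y y = 0" "x \<in> E i" for x y
  proof -
    have "y \<in> F (Suc j)" using that by (auto simp: F_def flag_Suc)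
    then show ?thesis using p(2)[of "(i, Suc j)"] that ij lt by (auto simp: paired_def)
  qed
  have psdM: "0 \<le> bform (Ms ! i) v v" if "v \<in> E i" for v
    using that regularD[OF Ms(1) lt(1)] by (auto simp: E_def)
  have psdX: "0 \<le> bform (Xs ! j) v v" if "v \<in> F j" for v
    using that regularD[OF Xs(1) lt(2)] by (auto simp: F_def)
  obtain x y where x: "x \<in> E i" and y: "y \<in> F j" and xy: "x \<bullet> y \<noteq> 0"
    and xo: "\<And>u. u \<in> E i \<Longrightarrow> u \<bullet> y = 0 \<Longrightarrow> bform (Ms ! i) x u = 0"
    and yo: "\<And>u. u \<in> F j \<Longrightarrow> x \<bullet> u = 0 \<Longrightarrow> bform (Xs ! j) y u = 0"
    using critical_pair[OF regular_sym[OF Ms(1) lt(1)] E[OF le(1)] psdM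
        regular_sym[OF Xs(1) lt(2)] F[OF le(2)] psdX kerM kerX xy0] by blast
  define z where "z = (1 / (x \<bullet> y)) *\<^sub>R y"
  have z: "z \<in> F j" "x \<bullet> z = 1" using y xy F[OF le(2)] by (auto simp: z_def subspace_scale)
  have "biorthogonal (Suc r) (e(r := x)) (f(r := z))"
    using bi x z by (auto simp: biorthogonal_def E_def F_def less_Suc_eq inner_commute)
  moreover have "adapted Ms (Suc r) (e(r := x)) (f(r := z)) (\<alpha>(r := i))"
  proof (rule adapted_Suc[OF adM lt(1)])
    show "x \<in> flag Ms i" using x by (simp add: E_def)
    show "0 < bform (Ms ! i) x x" using psdM[OF x] kerM[OF x _ y] xy by linarith
    show "bform (Ms ! i) x u = 0" if "u \<in> flag Ms i" "\<And>t. t < r \<Longrightarrow> u \<bullet> f t = 0" "u \<bullet> z = 0" for u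
      using xo[of u] that xy by (auto simp: E_def z_def)
  qed
  moreover have "adapted Xs (Suc r) (f(r := z)) (e(r := x)) (\<beta>(r := j))"
  proof (rule adapted_Suc[OF adX lt(2)])
    show "z \<in> flag Xs j" using z by (simp add: F_def)
    show "0 < bform (Xs ! j) z z" using psdX[OF z(1)] kerX[OF z(1) _ x] z(2) by linarith
    show "bform (Xs ! j) z u = 0" if "u \<in> flag Xs j" "\<And>t. t < r \<Longrightarrow> u \<bullet> e t = 0" "u \<bullet> x = 0" for u
      using yo[of u] that by (auto simp: F_def z_def inner_commute)
  qed
  ultimately show ?case by blast
qed

text \<open>With the identity appended the flag ends in zero, so every basis vector receives a
  level. The extra block is discarded again by \<open>sd_echelon_appendD\<close>.\<close>

lemma regular_snoc_mat_1:
  assumes "regular Ms"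
  shows "regular (Ms @ [mat 1])" "flag (Ms @ [mat 1]) (length (Ms @ [mat 1])) \<subseteq> {0}"
  using assms by (auto simp: regular_snoc mat_1_sym flag_Suc)

lemma sd_echelon_appendD:
  assumes "sd_echelon (Ms @ Ns)"
  shows "sd_echelon Ms"
proof -
  obtain P where P: "sd_echelon_struct (Ms @ Ns) P" using assms by (auto simp: sd_echelon_def)
  have nth: "(Ms @ Ns) ! i = Ms ! i" "take (length Ms) P ! i = P ! i" if "i < length Ms" for i
    using that by (auto simp: nth_append)
  have Q: "(\<Union>j<i. take (length Ms) P ! j) = (\<Union>j<i. P ! j)" if "i < length Ms" for i
    using that by auto
  have len: "length P = length Ms + length Ns" using P by (simp add: sd_echelon_struct_def)
  have "sd_echelon_struct Ms (take (length Ms) P)"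
    unfolding sd_echelon_struct_def Let_def
  proof (intro conjI)
    show "length (take (length Ms) P) = length Ms" "set Ms \<subseteq> sym_matrices"
      using P len by (auto simp: sd_echelon_struct_def)
    show "\<forall>i<length (take (length Ms) P). \<forall>j<length (take (length Ms) P). i \<noteq> j \<longrightarrow>
        take (length Ms) P ! i \<inter> take (length Ms) P ! j = {}"
      using P len by (simp add: sd_echelon_struct_def)
    note blocks = P[unfolded sd_echelon_struct_def Let_def, THEN conjunct2, THEN conjunct2, THEN conjunct2]
    show "\<forall>i<length Ms.
       (\<forall>a\<in>take (length Ms) P ! i. 0 < Ms ! i $ a $ a) \<and>
       (\<forall>a\<in>take (length Ms) P ! i. \<forall>b\<in>take (length Ms) P ! i. a \<noteq> b \<longrightarrow> Ms ! i $ a $ b = 0) \<and>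
       (\<forall>a b. a \<notin> (\<Union>j<i. take (length Ms) P ! j) \<and> b \<notin> (\<Union>j<i. take (length Ms) P ! j) \<and>
          \<not> (a \<in> take (length Ms) P ! i \<and> b \<in> take (length Ms) P ! i) \<longrightarrow> Ms ! i $ a $ b = 0)"
      (is "\<forall>i<length Ms. ?A i")
    proof (intro allI impI)
      fix i assume i: "i < length Ms"
      have "i < length (Ms @ Ns)" using i by simp
      from blocks[THEN spec, THEN mp, OF this] show "?A i"
        by (simp only: nth[OF i] Q[OF i])
    qed
  qed
  then show ?thesis by (auto simp: sd_echelon_def)
qed

text \<open>Block \<open>i\<close> collects the indices whose basis vector has level
  \<open>i\<close>. An entry outside the rows and columns of earlier blocks pairs two vectors of
  \<open>flag Ms i\<close>, and by \<open>flag_kernel\<close> it vanishes as soon as one of them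
  lies in the next member. Blocks are sets, so the order of the levels does not matter and
  \<open>h\<close> may be any numbering of the indices.\<close>

lemma sd_echelon_of_adapted:
  fixes T :: "real^'n^'n"
  assumes reg: "regular Ms" and bi: "biorthogonal r e f" and ad: "adapted Ms r e f \<alpha>"
    and h: "bij_betw h (UNIV :: 'n set) {..<r}" and T: "\<And>a. T *v axis a 1 = e (h a)"
  shows "sd_echelon (map (\<lambda>M. transpose T ** M ** T) Ms)"
proof -
  define P where "P = map (\<lambda>i. {a. \<alpha> (h a) = i}) [0..<length Ms]"
  have h': "h a < r" for a using h by (auto simp: bij_betw_def)
  have inj: "h a = h b \<longleftrightarrow> a = b" for a b using h by (auto simp: bij_betw_def inj_def)
  have entry: "(transpose T ** M ** T) $ a $ b = bform M (e (h a)) (e (h b))" for M a b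
    using bform_axis[where M = "transpose T ** M ** T" and a = a and b = b] by (simp add: bform_transform T)
  have fl: "e (h a) \<in> flag Ms i" if "i \<le> \<alpha> (h a)" for a i
    using ad h'[of a] flag_antimono[OF that, of Ms] by (auto simp: adapted_def)
  have zero: "bform (Ms ! i) (e (h a)) (e (h b)) = 0"
    if "i < length Ms" "i \<le> \<alpha> (h a)" "i \<le> \<alpha> (h b)" "\<not> (\<alpha> (h a) = i \<and> \<alpha> (h b) = i)" for a b i
  proof (cases "\<alpha> (h a) = i")
    case False
    then show ?thesis using that fl[of "Suc i" a] fl[of i b] by (intro flag_kernel[OF reg]) auto
  next
    case True
    then have "bform (Ms ! i) (e (h b)) (e (h a)) = 0"
      using that fl[of "Suc i" b] fl[of i a] by (intro flag_kernel[OF reg]) auto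
    then show ?thesis using bform_commute[OF regular_sym[OF reg that(1)]] by simp
  qed
  have pos: "0 < bform (Ms ! \<alpha> (h a)) (e (h a)) (e (h a))" for a
    using ad h'[of a] by (auto simp: adapted_def)
  have orth: "bform (Ms ! \<alpha> (h a)) (e (h a)) (e (h b)) = 0" if "a \<noteq> b" "\<alpha> (h b) = \<alpha> (h a)" for a b
    using adapted_orthogonal[OF reg bi ad, of "h a" "h b"] that h' inj by simp
  have "sd_echelon_struct (map (\<lambda>M. transpose T ** M ** T) Ms) P"
    unfolding sd_echelon_struct_def Let_def
  proof (intro conjI)
    show "length P = length (map (\<lambda>M. transpose T ** M ** T) Ms)" by (simp add: P_def)
    show "set (map (\<lambda>M. transpose T ** M ** T) Ms) \<subseteq> sym_matrices"
      using reg by (auto simp: regular_def intro!: sym_matrices_transform)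
    show "\<forall>i<length P. \<forall>j<length P. i \<noteq> j \<longrightarrow> P ! i \<inter> P ! j = {}"
      by (auto simp: P_def)
    show "\<forall>i<length (map (\<lambda>M. transpose T ** M ** T) Ms).
        (\<forall>a\<in>P ! i. 0 < map (\<lambda>M. transpose T ** M ** T) Ms ! i $ a $ a) \<and>
        (\<forall>a\<in>P ! i. \<forall>b\<in>P ! i. a \<noteq> b \<longrightarrow> map (\<lambda>M. transpose T ** M ** T) Ms ! i $ a $ b = 0) \<and>
        (\<forall>a b. a \<notin> (\<Union>j<i. P ! j) \<and> b \<notin> (\<Union>j<i. P ! j) \<and> \<not> (a \<in> P ! i \<and> b \<in> P ! i) \<longrightarrow>
          map (\<lambda>M. transpose T ** M ** T) Ms ! i $ a $ b = 0)"
      (is "\<forall>i<_. ?A i \<and> ?B i \<and> ?C i")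
    proof (intro allI impI)
      fix i assume "i < length (map (\<lambda>M. transpose T ** M ** T) Ms)"
      then have i: "i < length Ms" by simp
      have P: "a \<in> P ! i \<longleftrightarrow> \<alpha> (h a) = i" for a using i by (simp add: P_def)
      have Q: "a \<notin> (\<Union>j<i. P ! j) \<longleftrightarrow> i \<le> \<alpha> (h a)" for a using i by (auto simp: P_def)
      have "?A i" using pos i by (auto simp: P entry)
      moreover have "?B i" using orth i by (auto simp: P entry)
      moreover have "?C i" unfolding P Q using zero[OF i] i by (auto simp: entry)
      ultimately show "?A i \<and> ?B i \<and> ?C i" by blast
    qed
  qed
  then show ?thesis by (auto simp: sd_echelon_def)
qed

text \<open>The columns of \<open>T\<close> are the vectors \<open>e\<close> and the rows of
  \<open>S\<close> the vectors \<open>f\<close>, so biorthogonality says exactly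
  \<open>S ** T = mat 1\<close>. Transforming the second sequence by the inverse preserves all trace
  pairings with the first.\<close>

theorem simultaneous_sd_echelon:
  fixes Ms Xs :: "(real^'n^'n) list"
  assumes "regular Ms" "regular Xs"
  obtains T S :: "real^'n^'n" where "T ** S = mat 1" "S ** T = mat 1"
    "sd_echelon (map (\<lambda>M. transpose T ** M ** T) Ms)"
    "sd_echelon (map (\<lambda>X. S ** X ** transpose S) Xs)"
proof -
  define r where "r = CARD('n)"
  obtain e f :: "nat \<Rightarrow> real^'n" and \<alpha> \<beta> where bi: "biorthogonal r e f"
    and adM: "adapted (Ms @ [mat 1]) r e f \<alpha>" and adX: "adapted (Xs @ [mat 1]) r f e \<beta>"
    using ex_adapted_biorthogonal[OF regular_snoc_mat_1[OF assms(1)] regular_snoc_mat_1[OF assms(2)], of r]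
    by (auto simp: r_def)
  obtain h where h: "bij_betw h (UNIV :: 'n set) {..<r}"
    using ex_bij_betw_finite_nat[of "UNIV :: 'n set"] by (auto simp: r_def atLeast0LessThan)
  have h': "h a < r" for a using h by (auto simp: bij_betw_def)
  have inj: "h a = h b \<longleftrightarrow> a = b" for a b using h by (auto simp: bij_betw_def inj_def)
  define T :: "real^'n^'n" where "T = (\<chi> a b. e (h b) $ a)"
  define S :: "real^'n^'n" where "S = (\<chi> a b. f (h a) $ b)"
  have "S ** T = mat 1"
  proof -
    have "(S ** T) $ a $ b = f (h a) \<bullet> e (h b)" for a b
      by (simp add: S_def T_def matrix_matrix_mult_def inner_vec_def)
    also have "f (h a) \<bullet> e (h b) = (if a = b then 1 else 0)" for a b
      using bi h' inj by (auto simp: biorthogonal_def inner_commute)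
    finally show ?thesis by (auto simp: vec_eq_iff mat_def)
  qed
  moreover from this have "T ** S = mat 1" by (simp add: matrix_left_right_inverse)
  moreover have "T *v axis a 1 = e (h a)" for a
    by (simp add: vec_eq_iff T_def matrix_vector_mult_basis column_def)
  then have "sd_echelon (map (\<lambda>M. transpose T ** M ** T) Ms)"
    using sd_echelon_of_adapted[OF regular_snoc_mat_1(1)[OF assms(1)] bi adM h]
    by (auto intro: sd_echelon_appendD)
  moreover have "transpose S *v axis a 1 = f (h a)" for a
    by (simp only: matrix_vector_mult_basis) (simp add: S_def column_def transpose_def vec_eq_iff)
  then have "sd_echelon (map (\<lambda>X. S ** X ** transpose S) Xs)"
    using sd_echelon_of_adapted[OF regular_snoc_mat_1(1)[OF assms(2)] biorthogonal_commute[OF bi] adX h,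
        of "transpose S"]
    by (simp only: transpose_transpose map_append) (blast intro: sd_echelon_appendD)
  ultimately show ?thesis using that by blast
qed

section \<open>Semidefinite matrices\<close>

lemma bform_add_matrix: "bform (M + N) u v = bform M u v + bform N u v"
  by (simp add: matrix_vector_mult_add_rdistrib inner_right_distrib)

lemma bform_scaleR_matrix: "bform (c *\<^sub>R M) u v = c * bform M u v"
  by (simp add: scaleR_matrix_vector_assoc[symmetric])

lemma mat_inner_eq_inner: "A \<in> sym_matrices \<Longrightarrow> A \<bullet>\<^sub>M X = A \<bullet> X"
proof -
  assume A: "A \<in> sym_matrices"
  have "A \<bullet>\<^sub>M X = (\<Sum>i\<in>UNIV. \<Sum>k\<in>UNIV. A $ i $ k * X $ k $ i)"
    by (simp add: mat_inner_def trace_def matrix_matrix_mult_def)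
  also have "\<dots> = (\<Sum>k\<in>UNIV. \<Sum>i\<in>UNIV. A $ k $ i * X $ k $ i)"
    using A by (subst sum.swap) (simp add: sym_matrices_iff)
  finally show ?thesis by (simp add: inner_vec_def)
qed

lemma mat_inner_add_right: "A \<bullet>\<^sub>M (X + Y) = A \<bullet>\<^sub>M X + A \<bullet>\<^sub>M Y"
  by (simp add: mat_inner_def matrix_add_ldistrib trace_add)

lemma mat_inner_add_left: "(A + B) \<bullet>\<^sub>M X = A \<bullet>\<^sub>M X + B \<bullet>\<^sub>M X"
  by (simp add: mat_inner_def trace_def matrix_matrix_mult_def sum.distrib distrib_right)

lemma mat_inner_scaleR_left: "(c *\<^sub>R A) \<bullet>\<^sub>M X = c * (A \<bullet>\<^sub>M X)"
  by (simp add: mat_inner_def trace_def matrix_matrix_mult_def sum_distrib_left mult_ac)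

lemma mat_inner_scaleR_right: "A \<bullet>\<^sub>M (c *\<^sub>R X) = c * (A \<bullet>\<^sub>M X)"
  by (simp add: mat_inner_def trace_def matrix_matrix_mult_def sum_distrib_left mult_ac)

lemma mat_inner_transform:
  fixes T S :: "real^'n^'n"
  assumes "T ** S = mat 1"
  shows "(transpose T ** A ** T) \<bullet>\<^sub>M (S ** X ** transpose S) = A \<bullet>\<^sub>M X"
proof -
  have "transpose S ** transpose T = mat 1"
    using assms by (metis matrix_transpose_mul transpose_mat)
  moreover have "(transpose T ** A ** T) ** (S ** X ** transpose S) =
      transpose T ** (A ** (T ** S) ** X ** transpose S)"
    by (simp add: matrix_mul_assoc)
  moreover have "trace (transpose T ** (A ** X ** transpose S)) = trace (A ** X ** (transpose S ** transpose T))"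
    by (subst trace_mul_sym) (simp add: matrix_mul_assoc)
  ultimately show ?thesis using assms by (simp add: mat_inner_def)
qed

section \<open>Rank-one matrices and positivity of pairings\<close>

definition outer :: "real^'n \<Rightarrow> real^'n^'n" where
  "outer u = (\<chi> a b. u $ a * u $ b)"

lemma inner_outer: "M \<bullet> outer u = bform M u u"
  unfolding bform_entries by (simp add: inner_vec_def outer_def mult_ac)

lemma outer_vector: "outer u *v v = (u \<bullet> v) *\<^sub>R u"
  by (simp add: vec_eq_iff outer_def matrix_vector_mult_def inner_vec_def sum_distrib_left mult_ac)

lemma outer_psd: "outer u \<in> psd_cone"
  by (auto simp: psd_cone_def sym_matrices_iff outer_vector inner_commute) (simp add: outer_def mult.commute)

lemma psd_sym: "X \<in> psd_cone \<Longrightarrow> X \<in> sym_matrices"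
  by (simp add: psd_cone_def)

lemma psd_cone_add: "X \<in> psd_cone \<Longrightarrow> Y \<in> psd_cone \<Longrightarrow> X + Y \<in> psd_cone"
  by (auto simp: psd_cone_def bform_add_matrix subspace_add[OF subspace_sym_matrices])

lemma psd_cone_scaleR: "X \<in> psd_cone \<Longrightarrow> 0 \<le> c \<Longrightarrow> c *\<^sub>R X \<in> psd_cone"
  by (auto simp: psd_cone_def bform_scaleR_matrix subspace_scale[OF subspace_sym_matrices])

lemma convex_cone_psd_cone: "convex_cone psd_cone"
proof -
  have "0 \<in> psd_cone" by (simp add: psd_cone_def subspace_0[OF subspace_sym_matrices])
  then show ?thesis
    by (auto simp: convex_cone_iff psd_cone_add psd_cone_scaleR)
qed

lemma psd_cone_transform:
  fixes T :: "real^'n^'n"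
  shows "X \<in> psd_cone \<Longrightarrow> transpose T ** X ** T \<in> psd_cone"
  by (auto simp: psd_cone_def sym_matrices_transform bform_transform)

text \<open>A spectral decomposition from the echelon theorem: \<open>X\<close> alone is a regular
  sequence, and with an empty dual sequence a congruence gives it the shape of a first echelon
  matrix, that is, a nonnegative diagonal \<open>D\<close>. The summands are the rows of the inverse
  transformation, scaled by square roots of the diagonal.\<close>

lemma psd_cone_sum_outer:
  fixes X :: "real^'n^'n"
  assumes "X \<in> psd_cone"
  obtains u :: "'n \<Rightarrow> real^'n" where "X = (\<Sum>a\<in>UNIV. outer (u a))"
proof -
  have "regular [X]" "regular []" using assms by (auto simp: regular_def psd_cone_def)
  then obtain T S :: "real^'n^'n" where TS: "T ** S = mat 1" "S ** T = mat 1"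
    and "sd_echelon (map (\<lambda>X. transpose T ** X ** T) [X])"
    using simultaneous_sd_echelon by blast
  then have ech: "sd_echelon [transpose T ** X ** T]" by simp
  define D where "D = transpose T ** X ** T"
  obtain P where P: "\<forall>a\<in>P. 0 < D $ a $ a" "\<forall>a\<in>P. \<forall>b\<in>P. a \<noteq> b \<longrightarrow> D $ a $ b = 0"
    "\<forall>a b. \<not> (a \<in> P \<and> b \<in> P) \<longrightarrow> D $ a $ b = 0"
    using ech unfolding sd_echelon_def sd_echelon_struct_def D_def by auto
  have diag: "D $ a $ b = 0" if "a \<noteq> b" for a b using P that by blast
  have nonneg: "0 \<le> D $ a $ a" for a using P by (metis less_eq_real_def)
  have "transpose S ** transpose T = mat 1"
    using TS(1) by (metis matrix_transpose_mul transpose_mat)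
  moreover have "transpose S ** D ** S = (transpose S ** transpose T) ** X ** (T ** S)"
    by (simp only: D_def matrix_mul_assoc)
  ultimately have X: "X = transpose S ** D ** S"
    using TS(1) by simp
  have "X $ i $ j = (\<Sum>a\<in>UNIV. outer (sqrt (D $ a $ a) *\<^sub>R row a S)) $ i $ j" for i j
  proof -
    have "X $ i $ j = (\<Sum>b\<in>UNIV. (\<Sum>a\<in>UNIV. S $ a $ i * D $ a $ b) * S $ b $ j)"
      unfolding X by (simp add: matrix_matrix_mult_def transpose_def)
    also have "\<dots> = (\<Sum>b\<in>UNIV. S $ b $ i * D $ b $ b * S $ b $ j)"
    proof (rule sum.cong[OF refl])
      fix b
      have "(\<Sum>a\<in>UNIV. S $ a $ i * D $ a $ b) = (\<Sum>a\<in>UNIV. if a = b then S $ b $ i * D $ b $ b else 0)"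
        using diag by (intro sum.cong) auto
      then show "(\<Sum>a\<in>UNIV. S $ a $ i * D $ a $ b) * S $ b $ j = S $ b $ i * D $ b $ b * S $ b $ j"
        by simp
    qed
    also have "\<dots> = (\<Sum>a\<in>UNIV. outer (sqrt (D $ a $ a) *\<^sub>R row a S)) $ i $ j"
    proof -
      have "outer (sqrt (D $ a $ a) *\<^sub>R row a S) $ i $ j = S $ a $ i * D $ a $ a * S $ a $ j" for a
      proof -
        have "outer (sqrt (D $ a $ a) *\<^sub>R row a S) $ i $ j =
            S $ a $ i * (sqrt (D $ a $ a) * sqrt (D $ a $ a)) * S $ a $ j"
          by (simp add: outer_def row_def)
        then show ?thesis using nonneg[of a] by simp
      qed
      then show ?thesis by simp
    qed
    finally show ?thesis .
  qed
  then have "X = (\<Sum>a\<in>UNIV. outer (sqrt (D $ a $ a) *\<^sub>R row a S))"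
    by (simp add: vec_eq_iff)
  then show ?thesis by (rule that)
qed

lemma inner_psd_nonneg:
  fixes M X :: "real^'n^'n"
  assumes "\<And>v. 0 \<le> bform M v v" "X \<in> psd_cone"
  shows "0 \<le> M \<bullet> X"
proof -
  obtain u :: "'n \<Rightarrow> real^'n" where "X = (\<Sum>a\<in>UNIV. outer (u a))" using psd_cone_sum_outer[OF assms(2)] by blast
  then show ?thesis by (simp add: inner_sum_right inner_outer assms(1) sum_nonneg)
qed

text \<open>Why an echelon sequence certifies infeasibility: with \<open>X\<close> a sum of
  \<open>outer (u a)\<close>, a vanishing inner product is a vanishing sum of nonnegative values. So
  all \<open>u a\<close> pass from each flag member to the next, up to the one on which
  \<open>Ms ! k\<close> is nonnegative.\<close>

lemma regular_inner_psd_nonneg: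
  fixes X :: "real^'n^'n"
  assumes reg: "regular Ms" and k: "k < length Ms" and X: "X \<in> psd_cone"
    and zero: "\<And>i. i < k \<Longrightarrow> Ms ! i \<bullet> X = 0"
  shows "0 \<le> Ms ! k \<bullet> X"
proof -
  obtain u :: "'n \<Rightarrow> real^'n" where u: "X = (\<Sum>a\<in>UNIV. outer (u a))" using psd_cone_sum_outer[OF X] by blast
  have inner: "M \<bullet> X = (\<Sum>a\<in>UNIV. bform M (u a) (u a))" for M
    by (simp add: u inner_sum_right inner_outer)
  have "\<forall>a. u a \<in> flag Ms i" if "i \<le> k" for i
    using that
  proof (induction i)
    case (Suc i)
    then have i: "i < length Ms" "i < k" and IH: "\<forall>a. u a \<in> flag Ms i" using k by auto
    have "0 \<le> bform (Ms ! i) (u a) (u a)" for a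
      using regularD[OF reg i(1)] IH by blast
    moreover have "(\<Sum>a\<in>UNIV. bform (Ms ! i) (u a) (u a)) = 0"
      using zero[OF i(2)] unfolding inner .
    ultimately have "\<forall>a. bform (Ms ! i) (u a) (u a) = 0"
      by (subst (asm) sum_nonneg_eq_0_iff) auto
    with IH show ?case by (simp add: flag_Suc)
  qed simp
  from this[of k] have "u a \<in> flag Ms k" for a by simp
  then have "0 \<le> bform (Ms ! k) (u a) (u a)" for a by (rule regularD[OF reg k])
  then show ?thesis unfolding inner by (simp add: sum_nonneg)
qed

text \<open>On vectors that vanish on the earlier blocks, the echelon pattern leaves a positively
  weighted sum of squares over the own block (\<open>val\<close>). Its zeros vanish on that block
  too, so each further flag member forces the coordinates of one more block to be zero.\<close>

lemma regular_of_sd_echelon: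
  assumes "sd_echelon Ms"
  shows "regular Ms"
proof -
  obtain P where "sd_echelon_struct Ms P" using assms by (auto simp: sd_echelon_def)
  note P = this[unfolded sd_echelon_struct_def Let_def]
  have sym: "set Ms \<subseteq> sym_matrices" using P by (elim conjE)
  note blocks = P[THEN conjunct2, THEN conjunct2, THEN conjunct2, THEN spec, THEN mp]
  have pos: "0 < Ms ! i $ a $ a" if "i < length Ms" "a \<in> P ! i" for i a
    using blocks[OF that(1)] that(2) by simp
  have diag: "Ms ! i $ a $ b = 0" if "i < length Ms" "a \<in> P ! i" "b \<in> P ! i" "a \<noteq> b" for i a b
    using blocks[OF that(1)] that(2-) by simp
  have out: "Ms ! i $ a $ b = 0" if "i < length Ms" "a \<notin> (\<Union>j<i. P ! j)" "b \<notin> (\<Union>j<i. P ! j)"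
    "\<not> (a \<in> P ! i \<and> b \<in> P ! i)" for i a b
    using blocks[OF that(1), THEN conjunct2, THEN conjunct2, THEN spec, THEN spec, THEN mp, of a b] that(2-)
    by (simp only: not_False_eq_True simp_thms)
  have val: "bform (Ms ! i) v v = (\<Sum>a\<in>P ! i. Ms ! i $ a $ a * (v $ a)\<^sup>2)"
    if i: "i < length Ms" and v: "\<And>a. a \<in> (\<Union>j<i. P ! j) \<Longrightarrow> v $ a = 0" for i v
  proof -
    have "(\<Sum>b\<in>UNIV. Ms ! i $ a $ b * v $ a * v $ b) =
        (if a \<in> P ! i then Ms ! i $ a $ a * (v $ a)\<^sup>2 else 0)" for a
    proof -
      have "Ms ! i $ a $ b * v $ a * v $ b =
          (if b = a then if a \<in> P ! i then Ms ! i $ a $ a * (v $ a)\<^sup>2 else 0 else 0)" for b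
      proof (cases "a \<in> (\<Union>j<i. P ! j) \<or> b \<in> (\<Union>j<i. P ! j)")
        case True
        then show ?thesis using v by (cases "a = b") auto
      next
        case False
        moreover have "Ms ! i $ a $ b = 0" if "\<not> (a \<in> P ! i \<and> b \<in> P ! i)"
          using out[OF i] False that by blast
        moreover have "Ms ! i $ a $ b = 0" if "a \<in> P ! i \<and> b \<in> P ! i" "a \<noteq> b"
          using diag[OF i] that by blast
        ultimately show ?thesis by (cases "a = b") (auto simp: power2_eq_square)
      qed
      then show ?thesis by simp
    qed
    then show ?thesis
      unfolding bform_entries by (simp add: sum.If_cases)
  qed
  have nonneg: "0 \<le> Ms ! i $ a $ a * (v $ a)\<^sup>2" if "i < length Ms" "a \<in> P ! i" for i a v
    using pos[OF that] by (simp add: less_imp_le)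
  have flag: "\<forall>a \<in> (\<Union>j<i. P ! j). v $ a = 0" if "i \<le> length Ms" "v \<in> flag Ms i" for i v
    using that
  proof (induction i)
    case (Suc i)
    then have IH: "\<forall>a \<in> (\<Union>j<i. P ! j). v $ a = 0" by (simp add: flag_Suc)
    then have "bform (Ms ! i) v v = (\<Sum>a\<in>P ! i. Ms ! i $ a $ a * (v $ a)\<^sup>2)"
      using Suc.prems(1) by (intro val) auto
    then have "(\<Sum>a\<in>P ! i. Ms ! i $ a $ a * (v $ a)\<^sup>2) = 0"
      using Suc.prems(2) by (simp add: flag_Suc)
    then have "\<forall>a\<in>P ! i. Ms ! i $ a $ a * (v $ a)\<^sup>2 = 0"
      using nonneg Suc.prems(1) by (subst (asm) sum_nonneg_eq_0_iff) auto
    then have "\<forall>a\<in>P ! i. v $ a = 0"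
      using pos[of i] Suc.prems(1) by fastforce
    with IH show ?case by (auto simp: less_Suc_eq)
  qed simp
  show ?thesis
    unfolding regular_def
  proof (intro conjI allI impI ballI)
    show "set Ms \<subseteq> sym_matrices" by (rule sym)
    fix i v assume i: "i < length Ms" "v \<in> flag Ms i"
    then have "bform (Ms ! i) v v = (\<Sum>a\<in>P ! i. Ms ! i $ a $ a * (v $ a)\<^sup>2)"
      using val[of i v] flag[of i v] by simp
    then show "0 \<le> bform (Ms ! i) v v" using nonneg i(1) by (simp add: sum_nonneg)
  qed
qed

text \<open>By homogeneity only unit vectors matter. On the compact set \<open>S0\<close>, where
  \<open>N\<close> is not positive, \<open>M\<close> has a positive minimum, so a large multiple of
  it dominates; elsewhere \<open>N\<close> is positive already.\<close>

lemma finsler: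
  fixes M N :: "real^'n^'n"
  assumes V: "subspace V" and M: "\<And>v. v \<in> V \<Longrightarrow> 0 \<le> bform M v v"
    and N: "\<And>v. v \<in> V \<Longrightarrow> v \<noteq> 0 \<Longrightarrow> bform M v v = 0 \<Longrightarrow> 0 < bform N v v"
  obtains t where "\<And>v. v \<in> V \<Longrightarrow> v \<noteq> 0 \<Longrightarrow> 0 < bform (N + t *\<^sub>R M) v v"
proof -
  define S where "S = V \<inter> sphere 0 1"
  define S0 where "S0 = S \<inter> {v. bform N v v \<le> 0}"
  have cont: "continuous_on A (\<lambda>v. bform L v v)" for A :: "(real^'n) set" and L :: "real^'n^'n"
    by (intro continuous_intros)
  have S: "compact S" unfolding S_def using V by (auto intro!: closed_Int_compact closed_subspace)
  have "closed {v. bform N v v \<le> 0}" by (intro closed_Collect_le cont continuous_intros)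
  then have S0: "compact S0" unfolding S0_def using S by (rule compact_Int_closed[rotated])
  have nz: "v \<noteq> 0" if "v \<in> S" for v using that by (auto simp: S_def)
  have "\<exists>t\<ge>0. \<forall>v\<in>S0. 0 < bform N v v + t * bform M v v"
  proof (cases "S0 = {}")
    case False
    obtain p where p: "p \<in> S0" "\<And>v. v \<in> S0 \<Longrightarrow> bform M p p \<le> bform M v v"
      using continuous_attains_inf[OF S0 False cont] by blast
    obtain q where q: "q \<in> S0" "\<And>v. v \<in> S0 \<Longrightarrow> bform N q q \<le> bform N v v"
      using continuous_attains_inf[OF S0 False cont] by blast
    have "bform M p p \<noteq> 0" using N[of p] p(1) nz[of p] by (auto simp: S0_def S_def)
    then have pos: "0 < bform M p p" using M[of p] p(1) by (auto simp: S0_def S_def)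
    \<comment> \<open>\<open>t\<close> times the minimum of \<open>M\<close> on \<open>S0\<close>
      equals 1 minus the minimum of \<open>N\<close>, so the sum of the two forms is at least 1 on
      \<open>S0\<close>.\<close>
    define t where "t = (1 - bform N q q) / bform M p p"
    have q0: "bform N q q \<le> 0" using q(1) by (simp add: S0_def)
    have t: "0 \<le> t" using q0 pos by (simp add: t_def)
    have "0 < bform N v v + t * bform M v v" if v: "v \<in> S0" for v
    proof -
      have "1 - bform N q q = t * bform M p p" using pos by (simp add: t_def)
      also have "\<dots> \<le> t * bform M v v" using p(2)[OF v] t by (rule mult_left_mono)
      finally show ?thesis using q(2)[OF v] by linarith
    qed
    with t show ?thesis by blast
  qed auto
  then obtain t where t: "0 \<le> t" "\<And>v. v \<in> S0 \<Longrightarrow> 0 < bform N v v + t * bform M v v" by blast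
  have onS: "0 < bform (N + t *\<^sub>R M) v v" if "v \<in> S" for v
  proof (cases "v \<in> S0")
    case False
    then have "0 < bform N v v" using that by (simp add: S0_def)
    moreover have "0 \<le> t * bform M v v" using t(1) M that by (simp add: S_def)
    ultimately show ?thesis by (simp add: bform_add_matrix bform_scaleR_matrix)
  qed (simp add: t(2) bform_add_matrix bform_scaleR_matrix)
  show ?thesis
  proof
    fix v assume v: "v \<in> V" "v \<noteq> 0"
    define w where "w = (1 / norm v) *\<^sub>R v"
    have w: "w \<in> S" "v = norm v *\<^sub>R w" using v V by (auto simp: w_def S_def subspace_scale)
    have "bform (N + t *\<^sub>R M) v v = norm v * (norm v * bform (N + t *\<^sub>R M) w w)"
      by (subst (1 2) w(2)) (simp only: bform_scaleR_left bform_scaleR_right)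
    then show "0 < bform (N + t *\<^sub>R M) v v" using onS[OF w(1)] v by simp
  qed
qed

text \<open>The flag is climbed backwards, from member \<open>l\<close> to the whole space. The term
  with \<open>\<epsilon>\<close> makes the form definite on member \<open>l\<close>. From
  \<open>flag Xs (Suc i)\<close> to \<open>flag Xs i\<close>, \<open>finsler\<close> restores
  definiteness by a multiple of \<open>Xs ! i\<close>, whose zeros in the larger member form the
  smaller one.\<close>

lemma regular_positive_combination:
  fixes Xs :: "(real^'n^'n) list"
  assumes reg: "regular Xs" and l: "l < length Xs" and "0 < \<epsilon>"
  obtains Y where "Y \<in> span (set (take l Xs))" "Xs ! l + \<epsilon> *\<^sub>R mat 1 + Y \<in> psd_cone"
proof -
  have "\<exists>Y\<in>span (set (take l Xs)). \<forall>v\<in>flag Xs i. v \<noteq> 0 \<longrightarrow> 0 < bform (Xs ! l + \<epsilon> *\<^sub>R mat 1 + Y) v v"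
    if "i \<le> l" for i
    using that
  proof (induction rule: inc_induct)
    case base
    have "0 < bform (Xs ! l + \<epsilon> *\<^sub>R mat 1 + 0) v v" if "v \<in> flag Xs l" "v \<noteq> 0" for v
      using regularD[OF reg l that(1)] that(2) \<open>0 < \<epsilon>\<close>
      by (simp add: bform_add_matrix bform_scaleR_matrix add_nonneg_pos del: add_0_right)
    then show ?case using span_zero by blast
  next
    case (step i)
    then obtain Y where Y: "Y \<in> span (set (take l Xs))"
      "\<forall>v\<in>flag Xs (Suc i). v \<noteq> 0 \<longrightarrow> 0 < bform (Xs ! l + \<epsilon> *\<^sub>R mat 1 + Y) v v" by blast
    have i: "i < length Xs" using step l by simp
    obtain t where t: "\<And>v. v \<in> flag Xs i \<Longrightarrow> v \<noteq> 0 \<Longrightarrow> 0 < bform (Xs ! l + \<epsilon> *\<^sub>R mat 1 + Y + t *\<^sub>R Xs ! i) v v"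
      using finsler[OF subspace_flag[OF reg, of i], of "Xs ! i" "Xs ! l + \<epsilon> *\<^sub>R mat 1 + Y"]
        regularD[OF reg i] Y(2) i by (auto simp: flag_Suc)
    have "Xs ! i \<in> set (take l Xs)" using step l by (auto simp: in_set_conv_nth)
    then have "Y + t *\<^sub>R Xs ! i \<in> span (set (take l Xs))"
      using Y(1) by (metis span_add span_scale span_base)
    with t show ?case by (metis add.assoc)
  qed
  from this[of 0] obtain Y where Y: "Y \<in> span (set (take l Xs))"
    "\<forall>v. v \<noteq> 0 \<longrightarrow> 0 < bform (Xs ! l + \<epsilon> *\<^sub>R mat 1 + Y) v v" by auto
  have "span (set (take l Xs)) \<subseteq> sym_matrices"
    using reg set_take_subset[of l Xs] subspace_sym_matrices unfolding regular_def by (intro span_minimal) auto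
  then have "Xs ! l + \<epsilon> *\<^sub>R mat 1 + Y \<in> sym_matrices"
    using Y(1) regular_sym[OF reg l] mat_1_sym
    by (auto intro!: subspace_add[OF subspace_sym_matrices] subspace_scale[OF subspace_sym_matrices])
  moreover have "0 \<le> bform (Xs ! l + \<epsilon> *\<^sub>R mat 1 + Y) v v" for v
    using Y(2) by (cases "v = 0") (auto simp: less_imp_le)
  ultimately show ?thesis using that[OF Y(1)] by (simp add: psd_cone_def)
qed

section \<open>The image cone under reformulation\<close>

text \<open>Coefficients are indexed by position rather than by matrix, because reformulation acts
  on positions and the list may contain repetitions.\<close>

lemma mem_span_list:
  assumes "x \<in> span (set xs)"
  obtains \<beta> :: "nat \<Rightarrow> real" where "x = (\<Sum>r<length xs. \<beta> r *\<^sub>R xs ! r)"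
proof -
  let ?S = "{\<Sum>r<length xs. \<beta> r *\<^sub>R xs ! r | \<beta> :: nat \<Rightarrow> real. True}"
  have "subspace ?S"
    unfolding subspace_def
  proof (intro conjI ballI allI)
    show "0 \<in> ?S" by (auto intro!: exI[of _ "\<lambda>_. 0"])
  next
    fix x y assume "x \<in> ?S" "y \<in> ?S"
    then obtain \<beta> \<gamma> :: "nat \<Rightarrow> real" where "x = (\<Sum>r<length xs. \<beta> r *\<^sub>R xs ! r)"
      "y = (\<Sum>r<length xs. \<gamma> r *\<^sub>R xs ! r)" by blast
    then have "x + y = (\<Sum>r<length xs. (\<beta> r + \<gamma> r) *\<^sub>R xs ! r)"
      by (simp add: scaleR_add_left sum.distrib)
    then show "x + y \<in> ?S" by (auto intro!: exI[of _ "\<lambda>r. \<beta> r + \<gamma> r"])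
  next
    fix c x assume "x \<in> ?S"
    then obtain \<beta> :: "nat \<Rightarrow> real" where "x = (\<Sum>r<length xs. \<beta> r *\<^sub>R xs ! r)" by blast
    then have "c *\<^sub>R x = (\<Sum>r<length xs. (c * \<beta> r) *\<^sub>R xs ! r)"
      by (simp add: scaleR_sum_right)
    then show "c *\<^sub>R x \<in> ?S" by (auto intro!: exI[of _ "\<lambda>r. c * \<beta> r"])
  qed
  moreover have "set xs \<subseteq> ?S"
  proof
    fix x assume "x \<in> set xs"
    then obtain s where s: "s < length xs" "x = xs ! s" by (auto simp: in_set_conv_nth)
    have "(\<Sum>r<length xs. (if r = s then 1 else 0) *\<^sub>R xs ! r) = (\<Sum>r<length xs. if r = s then xs ! s else 0)"
      by (intro sum.cong) auto
    then have "x = (\<Sum>r<length xs. (if r = s then 1 else 0) *\<^sub>R xs ! r)" using s by simp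
    then show "x \<in> ?S" by (intro CollectI exI[of _ "\<lambda>r. if r = s then 1 else 0"]) simp
  qed
  ultimately have "span (set xs) \<subseteq> ?S" by (intro span_minimal)
  with assms that show ?thesis by blast
qed

definition null_space :: "(real^'n^'n) list \<Rightarrow> (real^'n^'n) set" where
  "null_space As = {Y \<in> sym_matrices. \<forall>A\<in>set As. A \<bullet>\<^sub>M Y = 0}"

definition psd_plus_null :: "(real^'n^'n) list \<Rightarrow> (real^'n^'n) set" where
  "psd_plus_null As = {P + Y | P Y. P \<in> psd_cone \<and> Y \<in> null_space As}"

lemma subspace_null_space: "subspace (null_space As)"
  by (auto simp: null_space_def subspace_def mat_inner_add_right mat_inner_scaleR_right
      subspace_add[OF subspace_sym_matrices, unfolded subspace_def]
      subspace_scale[OF subspace_sym_matrices] subspace_add[OF subspace_sym_matrices]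
      subspace_0[OF subspace_sym_matrices])
     (simp add: mat_inner_def trace_def matrix_matrix_mult_def)

lemma null_space_span:
  "null_space As = {Y \<in> sym_matrices. \<forall>A\<in>span (set As). A \<bullet>\<^sub>M Y = 0}"
proof -
  have "A \<bullet>\<^sub>M Y = 0" if Y: "\<forall>A\<in>set As. A \<bullet>\<^sub>M Y = 0" and A: "A \<in> span (set As)" for A Y
    using A
  proof (induction rule: span_induct_alt)
    case base
    show ?case by (simp add: mat_inner_def trace_def matrix_matrix_mult_def)
  next
    case (step c A B)
    then show ?case using Y by (simp add: mat_inner_add_left mat_inner_scaleR_left)
  qed
  then show ?thesis by (auto simp: null_space_def span_base)
qed

lemma psd_plus_null_sym: "X \<in> psd_plus_null As \<Longrightarrow> X \<in> sym_matrices"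
  by (auto simp: psd_plus_null_def null_space_def intro: subspace_add[OF subspace_sym_matrices] psd_sym)

lemma rep_map_eq_iff:
  "rep_map As X = rep_map As Y \<longleftrightarrow> (\<forall>A\<in>set As. A \<bullet>\<^sub>M X = A \<bullet>\<^sub>M Y)"
  unfolding rep_map_def fun_eq_iff all_set_conv_all_nth by auto

lemma psd_plus_null_iff:
  "X \<in> psd_plus_null As \<longleftrightarrow> X \<in> sym_matrices \<and> rep_map As X \<in> rep_map As ` psd_cone"
proof
  assume X: "X \<in> psd_plus_null As"
  then obtain P Y where PY: "X = P + Y" "P \<in> psd_cone" "Y \<in> null_space As"
    by (auto simp: psd_plus_null_def)
  then have "rep_map As X = rep_map As P"
    unfolding rep_map_eq_iff by (auto simp: mat_inner_add_right null_space_def)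
  then show "X \<in> sym_matrices \<and> rep_map As X \<in> rep_map As ` psd_cone"
    using PY psd_plus_null_sym[OF X] by auto
next
  assume X: "X \<in> sym_matrices \<and> rep_map As X \<in> rep_map As ` psd_cone"
  then obtain P where P: "P \<in> psd_cone" "rep_map As X = rep_map As P" by auto
  have "A \<bullet>\<^sub>M (X - P) = 0" if "A \<in> set As" for A
    using P(2) that mat_inner_add_right[of A P "X - P"] unfolding rep_map_eq_iff by simp
  then have "X - P \<in> null_space As"
    using X psd_sym[OF P(1)] by (auto simp: null_space_def intro!: subspace_diff[OF subspace_sym_matrices])
  moreover have "X = P + (X - P)" by simp
  ultimately show "X \<in> psd_plus_null As"
    unfolding psd_plus_null_def using P(1) by blast
qed

text \<open>A linear section over the range: the combination of the \<open>G i\<close> is the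
  orthogonal projection of \<open>X\<close> to the span of \<open>As\<close>, computed from the
  values \<open>rep_map As X\<close> alone. The list may be dependent, so the projection is written
  in an orthonormal basis \<open>B\<close>, whose members are then expressed through
  \<open>As\<close>.\<close>

lemma rep_map_section:
  assumes As: "set As \<subseteq> sym_matrices"
  obtains G where "\<And>i. G i \<in> sym_matrices"
    "\<And>X. rep_map As (\<Sum>i<length As. rep_map As X i *\<^sub>R G i) = rep_map As X"
proof -
  obtain B where B: "pairwise orthogonal B" "\<And>x. x \<in> B \<Longrightarrow> norm x = 1" "independent B"
    "span B = span (set As)"
    using orthonormal_basis_subspace[OF subspace_span, of "set As"] by metis
  have fin: "finite B" using B(3) by (rule independent_imp_finite)
  have span_sym: "span (set As) \<subseteq> sym_matrices"
    using As subspace_sym_matrices by (intro span_minimal)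
  have Bspan: "b \<in> span (set As)" if "b \<in> B" for b using that B(4) span_base by blast
  have "\<forall>b\<in>B. \<exists>\<beta>. b = (\<Sum>r<length As. \<beta> r *\<^sub>R As ! r)"
    using mem_span_list Bspan by metis
  then obtain \<beta> where \<beta>: "\<And>b. b \<in> B \<Longrightarrow> b = (\<Sum>r<length As. \<beta> b r *\<^sub>R As ! r)" by metis
  define G where "G i = (\<Sum>b\<in>B. \<beta> b i *\<^sub>R b)" for i
  show ?thesis
  proof
    show "G i \<in> sym_matrices" for i
      unfolding G_def using Bspan span_sym
      by (intro subspace_sum[OF subspace_sym_matrices] subspace_scale[OF subspace_sym_matrices]) auto
  next
    fix X
    have rep: "rep_map As X i = As ! i \<bullet> X" if "i < length As" for i
    proof -
      have "As ! i \<in> sym_matrices" using that As nth_mem by blast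
      then show ?thesis using that by (simp add: rep_map_def mat_inner_eq_inner)
    qed
    have "(\<Sum>i<length As. rep_map As X i *\<^sub>R G i) = (\<Sum>b\<in>B. (\<Sum>i<length As. \<beta> b i * (As ! i \<bullet> X)) *\<^sub>R b)"
      unfolding G_def by (simp add: rep scaleR_sum_right scaleR_sum_left sum.swap[of _ B] mult.commute)
    also have "\<dots> = (\<Sum>b\<in>B. (b \<bullet> X) *\<^sub>R b)"
    proof (rule sum.cong[OF refl])
      fix b assume "b \<in> B"
      have "b \<bullet> X = (\<Sum>r<length As. \<beta> b r *\<^sub>R As ! r) \<bullet> X"
        using \<beta>[OF \<open>b \<in> B\<close>] by (rule arg_cong[where f = "\<lambda>x. x \<bullet> X"])
      then show "(\<Sum>i<length As. \<beta> b i * (As ! i \<bullet> X)) *\<^sub>R b = (b \<bullet> X) *\<^sub>R b"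
        by (simp add: inner_sum_left)
    qed
    finally have g: "(\<Sum>i<length As. rep_map As X i *\<^sub>R G i) = (\<Sum>b\<in>B. (b \<bullet> X) *\<^sub>R b)" .
    have "orthogonal (X - (\<Sum>b\<in>B. (b \<bullet> X) *\<^sub>R b)) b'" if "b' \<in> B" for b'
    proof -
      have "(\<Sum>b\<in>B. (b \<bullet> X) * (b \<bullet> b')) = (\<Sum>b\<in>B. if b = b' then b' \<bullet> X else 0)"
      proof (rule sum.cong[OF refl])
        fix b assume "b \<in> B"
        then show "(b \<bullet> X) * (b \<bullet> b') = (if b = b' then b' \<bullet> X else 0)"
          using B(1,2) that by (auto simp: pairwise_def orthogonal_def norm_eq_1)
      qed
      then have "(\<Sum>b\<in>B. (b \<bullet> X) * (b \<bullet> b')) = X \<bullet> b'"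
        using that fin by (simp add: inner_commute)
      then show ?thesis by (simp add: orthogonal_def inner_diff_left inner_sum_left)
    qed
    then have orth: "orthogonal (X - (\<Sum>b\<in>B. (b \<bullet> X) *\<^sub>R b)) A" if "A \<in> set As" for A
      using orthogonal_to_span[of A B] that B(4) span_base by blast
    show "rep_map As (\<Sum>i<length As. rep_map As X i *\<^sub>R G i) = rep_map As X"
      unfolding g rep_map_eq_iff
    proof
      fix A assume "A \<in> set As"
      then have "(X - (\<Sum>b\<in>B. (b \<bullet> X) *\<^sub>R b)) \<bullet> A = 0" "A \<in> sym_matrices"
        using orth[of A] As by (auto simp: orthogonal_def)
      then show "A \<bullet>\<^sub>M (\<Sum>b\<in>B. (b \<bullet> X) *\<^sub>R b) = A \<bullet>\<^sub>M X"
        by (simp only: mat_inner_eq_inner inner_diff_left) (simp add: inner_commute)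
    qed
  qed
qed

lemma closed_sym_matrices: "closed sym_matrices"
  by (intro closed_subspace subspace_sym_matrices)

lemma continuous_on_rep_map:
  assumes "set As \<subseteq> sym_matrices"
  shows "continuous_on UNIV (rep_map As)"
proof (rule continuous_on_coordinatewise_then_product)
  fix i
  show "continuous_on UNIV (\<lambda>X. rep_map As X i)"
  proof (cases "i < length As")
    case True
    then have "As ! i \<in> sym_matrices" using assms nth_mem by blast
    then have "rep_map As X i = As ! i \<bullet> X" for X
      using True by (simp add: rep_map_def mat_inner_eq_inner)
    then show ?thesis by (auto intro: continuous_intros)
  qed (simp add: rep_map_def)
qed

text \<open>Closedness passes to \<open>K\<close> by taking preimages under a continuous map.
  Conversely, \<open>rep_map As (g c) = c\<close> is a closed condition that selects the range of
  the map, and the image cone consists of the \<open>c\<close> satisfying it for which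
  \<open>g c\<close> lies in \<open>K\<close>.\<close>

lemma closedin_rep_map_iff:
  assumes As: "set As \<subseteq> sym_matrices"
  shows "closedin (Euclidean_space (length As)) (rep_map As ` psd_cone) \<longleftrightarrow> closed (psd_plus_null As)"
proof
  assume "closedin (Euclidean_space (length As)) (rep_map As ` psd_cone)"
  then have "closed (rep_map As ` psd_cone)" by (rule closedin_Euclidean_imp_closed)
  then have "closed (rep_map As -` (rep_map As ` psd_cone))"
    using continuous_on_rep_map[OF As] by (intro closed_vimage) auto
  moreover have "psd_plus_null As = sym_matrices \<inter> rep_map As -` (rep_map As ` psd_cone)"
    by (auto simp: psd_plus_null_iff)
  ultimately show "closed (psd_plus_null As)" by (simp add: closed_Int closed_sym_matrices)
next
  assume K: "closed (psd_plus_null As)"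
  obtain G where G: "\<And>i. G i \<in> sym_matrices"
    "\<And>X. rep_map As (\<Sum>i<length As. rep_map As X i *\<^sub>R G i) = rep_map As X"
    using rep_map_section[OF As] by blast
  define g where "g c = (\<Sum>i<length As. c i *\<^sub>R G i)" for c
  have g_sym: "g c \<in> sym_matrices" for c
    unfolding g_def using G(1)
    by (intro subspace_sum[OF subspace_sym_matrices] subspace_scale[OF subspace_sym_matrices])
  have g_rep: "rep_map As (g (rep_map As X)) = rep_map As X" for X
    unfolding g_def by (rule G(2))
  have cont_g: "continuous_on UNIV g"
    unfolding g_def by (intro continuous_intros) auto
  have cont: "continuous_on UNIV (\<lambda>c. rep_map As (g c) i)" for i
    using continuous_on_product_then_coordinatewise[OF
        continuous_on_compose2[OF continuous_on_rep_map[OF As] cont_g]] by simp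
  have "rep_map As ` psd_cone = {c. rep_map As (g c) = c} \<inter> g -` psd_plus_null As"
  proof (intro equalityI subsetI)
    fix c assume "c \<in> rep_map As ` psd_cone"
    then show "c \<in> {c. rep_map As (g c) = c} \<inter> g -` psd_plus_null As"
      using g_rep by (auto simp: psd_plus_null_iff g_sym)
  next
    fix c assume "c \<in> {c. rep_map As (g c) = c} \<inter> g -` psd_plus_null As"
    then have "rep_map As (g c) = c" "rep_map As (g c) \<in> rep_map As ` psd_cone"
      by (auto simp: psd_plus_null_iff)
    then show "c \<in> rep_map As ` psd_cone" by simp
  qed
  moreover have "closed {c. rep_map As (g c) = c}"
  proof -
    have "{c. rep_map As (g c) = c} = (\<Inter>i. {c. rep_map As (g c) i = c i})" by auto
    moreover have "closed (\<Inter>i. {c. rep_map As (g c) i = c i})"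
      using cont by (intro closed_INT ballI closed_Collect_eq) auto
    ultimately show ?thesis by simp
  qed
  moreover have "closed (g -` psd_plus_null As)"
    using K cont_g by (intro closed_vimage)
  ultimately have "closed (rep_map As ` psd_cone)" by (simp add: closed_Int)
  then show "closedin (Euclidean_space (length As)) (rep_map As ` psd_cone)"
    by (auto simp: closedin_Euclidean_space_iff topspace_Euclidean_space rep_map_def)
qed

section \<open>Effect of the reformulation operations\<close>

lemma span_combine:
  fixes As :: "(real^'n^'n) list"
  assumes "i < length As" "j < length As" "i \<noteq> j" "c \<noteq> 0"
  shows "span (set (As[i := c *\<^sub>R (As ! i) + d *\<^sub>R (As ! j)])) = span (set As)"
proof -
  define Bs where "Bs = As[i := c *\<^sub>R (As ! i) + d *\<^sub>R (As ! j)]"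
  have "set Bs \<subseteq> insert (c *\<^sub>R (As ! i) + d *\<^sub>R (As ! j)) (set As)"
    unfolding Bs_def by (rule set_update_subset_insert)
  moreover have "c *\<^sub>R (As ! i) + d *\<^sub>R (As ! j) \<in> span (set As)"
    using assms by (simp add: span_add span_scale span_base)
  ultimately have "set Bs \<subseteq> span (set As)" using span_superset by blast
  moreover have "As ! r \<in> span (set Bs)" if r: "r < length As" for r
  proof (cases "r = i")
    case False
    then have "As ! r = Bs ! r" "r < length Bs" using r by (auto simp: Bs_def)
    then show ?thesis by (metis nth_mem span_base)
  next
    case True
    have "Bs ! i \<in> span (set Bs)" "Bs ! j \<in> span (set Bs)"
      using assms by (metis Bs_def length_list_update nth_mem span_base)+
    then have "(1 / c) *\<^sub>R Bs ! i - (d / c) *\<^sub>R Bs ! j \<in> span (set Bs)"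
      by (intro span_diff span_scale)
    moreover have "(1 / c) *\<^sub>R Bs ! i - (d / c) *\<^sub>R Bs ! j = As ! i"
      using assms by (simp add: Bs_def scaleR_add_right)
    ultimately show ?thesis using True by simp
  qed
  then have "set As \<subseteq> span (set Bs)" by (auto simp: in_set_conv_nth)
  ultimately show ?thesis unfolding Bs_def[symmetric]
    by (metis span_eq)
qed

lemma linear_transform: "linear (\<lambda>X. S ** X ** (S' :: real^'n^'n))"
  by (rule linearI)
     (simp_all add: vec_eq_iff matrix_matrix_mult_def sum.distrib sum_distrib_left sum_distrib_right algebra_simps)

lemma psd_plus_null_transform:
  fixes T S :: "real^'n^'n"
  assumes "T ** S = mat 1" "X \<in> psd_plus_null As"
  shows "S ** X ** transpose S \<in> psd_plus_null (map (\<lambda>M. transpose T ** M ** T) As)"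
proof -
  obtain P Y where PY: "X = P + Y" "P \<in> psd_cone" "Y \<in> null_space As"
    using assms(2) by (auto simp: psd_plus_null_def)
  have "S ** X ** transpose S = S ** P ** transpose S + S ** Y ** transpose S"
    using linear_add[OF linear_transform] by (simp add: PY(1))
  moreover have "S ** P ** transpose S \<in> psd_cone"
    using psd_cone_transform[OF PY(2), of "transpose S"] by simp
  moreover have "S ** Y ** transpose S \<in> null_space (map (\<lambda>M. transpose T ** M ** T) As)"
    using PY(3) sym_matrices_transform[of Y "transpose S"] by (auto simp: null_space_def mat_inner_transform[OF assms(1)])
  ultimately show ?thesis by (auto simp: psd_plus_null_def)
qed

lemma transform_inverse:
  fixes T S :: "real^'n^'n"
  assumes "T ** S = mat 1"
  shows "transpose S ** (transpose T ** M ** T) ** S = M"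
proof -
  have "transpose S ** transpose T = mat 1"
    using assms by (metis matrix_transpose_mul transpose_mat)
  moreover have "transpose S ** (transpose T ** M ** T) ** S = (transpose S ** transpose T) ** M ** (T ** S)"
    by (simp only: matrix_mul_assoc)
  ultimately show ?thesis using assms by simp
qed

lemma closed_psd_plus_null_transform:
  fixes T :: "real^'n^'n"
  assumes "invertible T"
  shows "closed (psd_plus_null (map (\<lambda>M. transpose T ** M ** T) As)) \<longleftrightarrow> closed (psd_plus_null As)"
proof -
  obtain S where S: "T ** S = mat 1" "S ** T = mat 1" using assms by (auto simp: invertible_def)
  define Bs where "Bs = map (\<lambda>M. transpose T ** M ** T) As"
  have As: "As = map (\<lambda>M. transpose S ** M ** S) Bs"
    unfolding Bs_def by (simp add: comp_def transform_inverse[OF S(1)] map_idI)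
  have tr: "transpose S ** transpose T = mat 1" "transpose T ** transpose S = mat 1"
    using S by (metis matrix_transpose_mul transpose_mat)+
  have inv1: "T ** (S ** X ** transpose S) ** transpose T = X" for X
    using transform_inverse[OF tr(1), of X] by simp
  have inv2: "S ** (T ** X ** transpose T) ** transpose S = X" for X
    using transform_inverse[OF tr(2), of X] by simp
  have eq: "psd_plus_null Bs = (\<lambda>X. S ** X ** transpose S) ` psd_plus_null As"
  proof (intro equalityI subsetI)
    fix Z assume "Z \<in> psd_plus_null Bs"
    then have "T ** Z ** transpose T \<in> psd_plus_null As"
      using psd_plus_null_transform[OF S(2), of Z Bs] As by simp
    then show "Z \<in> (\<lambda>X. S ** X ** transpose S) ` psd_plus_null As" using inv2[of Z] by force
  next
    fix Z assume "Z \<in> (\<lambda>X. S ** X ** transpose S) ` psd_plus_null As"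
    then show "Z \<in> psd_plus_null Bs"
      unfolding Bs_def using psd_plus_null_transform[OF S(1)] by blast
  qed
  have "inj (\<lambda>X. S ** X ** transpose S)" using inv1 by (rule inj_on_inverseI)
  then show ?thesis
    unfolding Bs_def[symmetric] eq by (rule closed_injective_linear_image_eq[OF linear_transform])
qed

lemma psd_plus_null_cong: "span (set As) = span (set Bs) \<Longrightarrow> psd_plus_null As = psd_plus_null Bs"
  by (simp add: psd_plus_null_def null_space_span)

text \<open>Exchange and combination keep the span, hence \<open>K\<close> itself; a congruence
  moves \<open>K\<close> by an injective linear map.\<close>

lemma reformulation_step_invariant:
  assumes "reformulation_step As Bs" "set As \<subseteq> sym_matrices"
  shows "length Bs = length As \<and> set Bs \<subseteq> sym_matrices \<and>
    (closed (psd_plus_null Bs) \<longleftrightarrow> closed (psd_plus_null As))"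
  using assms
proof (induction rule: reformulation_step.induct)
  case (exchange i As j)
  then show ?case using psd_plus_null_cong[of "As[i := As ! j, j := As ! i]" As] by simp
next
  case (combine i As j c d)
  let ?Bs = "As[i := c *\<^sub>R (As ! i) + d *\<^sub>R (As ! j)]"
  have "span (set ?Bs) = span (set As)" using combine by (intro span_combine)
  moreover have "span (set As) \<subseteq> sym_matrices"
    using combine subspace_sym_matrices by (intro span_minimal)
  ultimately show ?case using psd_plus_null_cong[of ?Bs As] span_superset[of "set ?Bs"] by auto
next
  case (congruence T As)
  then show ?case using closed_psd_plus_null_transform[of T As] sym_matrices_transform[where T = T] by auto
qed

lemma reformulation_invariant:
  assumes "reformulation As Bs" "set As \<subseteq> sym_matrices"
  shows "length Bs = length As \<and> set Bs \<subseteq> sym_matrices \<and>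
    (closed (psd_plus_null Bs) \<longleftrightarrow> closed (psd_plus_null As))"
  using assms unfolding reformulation_def
  by (induction rule: rtranclp_induct) (auto dest!: reformulation_step_invariant)

lemma reformulation_trans:
  "reformulation As Bs \<Longrightarrow> reformulation Bs Cs \<Longrightarrow> reformulation As Cs"
  unfolding reformulation_def by simp

lemma reformulation_of_step: "reformulation_step As Bs \<Longrightarrow> reformulation As Bs"
  unfolding reformulation_def by blast

text \<open>A combination involves a second index even for pure scaling, hence
  \<open>J \<noteq> {}\<close>. The first index processed carries the factor \<open>c\<close>; for
  all others the entry at \<open>i\<close> is kept with factor 1.\<close>

lemma reformulation_replace:
  assumes i: "i < length As" and J: "finite J" "J \<noteq> {}" "J \<subseteq> {..<length As} - {i}" and c: "c \<noteq> 0"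
  shows "reformulation As (As[i := c *\<^sub>R As ! i + (\<Sum>j\<in>J. \<beta> j *\<^sub>R As ! j)])"
  using J
proof (induction rule: finite_ne_induct)
  case (singleton j)
  then show ?case using i c by (auto intro!: reformulation_of_step reformulation_step.combine)
next
  case (insert j J)
  let ?X = "c *\<^sub>R As ! i + (\<Sum>j\<in>J. \<beta> j *\<^sub>R As ! j)"
  have j: "j < length As" "i \<noteq> j" using insert by auto
  have "reformulation_step (As[i := ?X]) ((As[i := ?X])[i := 1 *\<^sub>R (As[i := ?X] ! i) + \<beta> j *\<^sub>R (As[i := ?X] ! j)])"
    using i j by (intro reformulation_step.combine) auto
  moreover have "(As[i := ?X])[i := 1 *\<^sub>R (As[i := ?X] ! i) + \<beta> j *\<^sub>R (As[i := ?X] ! j)] =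
      As[i := c *\<^sub>R As ! i + (\<Sum>j\<in>insert j J. \<beta> j *\<^sub>R As ! j)]"
    using i j insert.hyps by (simp add: add_ac)
  ultimately have "reformulation (As[i := ?X]) (As[i := c *\<^sub>R As ! i + (\<Sum>j\<in>insert j J. \<beta> j *\<^sub>R As ! j)])"
    by (simp only: reformulation_of_step)
  moreover have "reformulation As (As[i := ?X])" using insert by blast
  ultimately show ?case by (rule reformulation_trans[rotated])
qed

text \<open>A Steinitz exchange: since \<open>C\<close> is outside the span of the first
  \<open>i\<close> entries, it has a nonzero coefficient at some position \<open>r \<ge> i\<close>.
  Entry \<open>r\<close> is replaced by \<open>C\<close> and swapped to position \<open>i\<close>,
  so the prefix stays untouched.\<close>

lemma reformulation_insert:
  fixes As :: "(real^'n^'n) list"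
  assumes len: "2 \<le> length As" and C: "C \<in> span (set As)" "C \<notin> span (set (take i As))"
  obtains Bs where "reformulation As Bs" "take i Bs = take i As" "i < length Bs" "Bs ! i = C"
    "span (set Bs) = span (set As)"
proof -
  obtain \<beta> where \<beta>: "C = (\<Sum>r<length As. \<beta> r *\<^sub>R As ! r)" using mem_span_list[OF C(1)] by blast
  have "\<exists>r. i \<le> r \<and> r < length As \<and> \<beta> r \<noteq> 0"
  proof (rule ccontr)
    assume "\<not> (\<exists>r. i \<le> r \<and> r < length As \<and> \<beta> r \<noteq> 0)"
    then have zero: "\<beta> r = 0" if "i \<le> r" "r < length As" for r using that by blast
    have "\<beta> r *\<^sub>R As ! r \<in> span (set (take i As))" if "r < length As" for r
    proof (cases "i \<le> r")
      case False
      then have "As ! r \<in> set (take i As)" using that by (auto simp: in_set_conv_nth)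
      then show ?thesis by (intro span_scale span_base)
    qed (use zero that in \<open>simp add: span_zero\<close>)
    then have "C \<in> span (set (take i As))" unfolding \<beta> by (intro span_sum) auto
    with C(2) show False by simp
  qed
  then obtain r where r: "i \<le> r" "r < length As" "\<beta> r \<noteq> 0" by blast
  define J where "J = {..<length As} - {r}"
  have J: "finite J" "J \<noteq> {}" "J \<subseteq> {..<length As} - {r}"
  proof -
    \<comment> \<open>A position other than \<open>r\<close>, which exists because the list has at
      least two entries.\<close>
    have "(if r = 0 then 1 else 0) \<in> J" using len by (auto simp: J_def)
    then show "J \<noteq> {}" by blast
  qed (auto simp: J_def)
  have "C = \<beta> r *\<^sub>R As ! r + (\<Sum>j\<in>J. \<beta> j *\<^sub>R As ! j)"
    unfolding \<beta> J_def using r(2) by (subst sum.remove[of _ r]) auto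
  then have ref: "reformulation As (As[r := C])"
    using reformulation_replace[OF r(2) J r(3), of \<beta>] by simp
  define Cs where "Cs = As[r := C]"
  define Bs where "Bs = Cs[i := Cs ! r, r := Cs ! i]"
  have Bs: "reformulation Cs Bs"
  proof (cases "i = r")
    case True
    then have "Bs = Cs" by (simp add: Bs_def)
    then show ?thesis by (simp add: reformulation_def)
  next
    case False
    then show ?thesis unfolding Bs_def
      using r by (intro reformulation_of_step reformulation_step.exchange) (auto simp: Cs_def)
  qed
  have "set Bs = set Cs" unfolding Bs_def using r by (intro set_swap) (auto simp: Cs_def)
  moreover have "span (set Cs) = span (set As)"
  proof -
    have "set Cs \<subseteq> span (set As)"
      using C(1) span_superset set_update_subset_insert[of As r C] unfolding Cs_def by blast
    moreover have "As ! s \<in> span (set Cs)" if s: "s < length As" for s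
    proof (cases "s = r")
      case False
      then have "As ! s = Cs ! s" "s < length Cs" using s by (auto simp: Cs_def)
      then show ?thesis by (metis nth_mem span_base)
    next
      case True
      have "C \<in> span (set Cs)" using r by (auto simp: Cs_def intro!: span_base set_update_memI)
      moreover have "(\<Sum>j\<in>J. \<beta> j *\<^sub>R As ! j) \<in> span (set Cs)"
      proof (intro span_sum span_scale)
        fix j assume "j \<in> J"
        then have "As ! j = Cs ! j" "j < length Cs" by (auto simp: J_def Cs_def)
        then show "As ! j \<in> span (set Cs)" by (metis nth_mem span_base)
      qed
      ultimately have "(1 / \<beta> r) *\<^sub>R (C - (\<Sum>j\<in>J. \<beta> j *\<^sub>R As ! j)) \<in> span (set Cs)"
        by (intro span_scale span_diff)
      then show ?thesis
        using \<open>C = \<beta> r *\<^sub>R As ! r + _\<close> r(3) True by simp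
    qed
    then have "set As \<subseteq> span (set Cs)" by (auto simp: in_set_conv_nth)
    ultimately show ?thesis by (metis span_eq)
  qed
  moreover have "take i Bs = take i As" using r by (simp add: Bs_def Cs_def take_update_cancel)
  moreover have "Bs ! i = C" "i < length Bs" using r by (auto simp: Bs_def Cs_def nth_list_update)
  ultimately show ?thesis using that reformulation_trans[OF ref[folded Cs_def] Bs] by simp
qed

lemma reformulation_prefix:
  fixes As Ms :: "(real^'n^'n) list"
  assumes len: "2 \<le> length As" and sp: "set Ms \<subseteq> span (set As)"
    and ind: "\<And>i. i < length Ms \<Longrightarrow> Ms ! i \<notin> span (set (take i Ms))"
  obtains Bs where "reformulation As Bs" "length Ms \<le> length Bs" "take (length Ms) Bs = Ms"
    "span (set Bs) = span (set As)"
proof -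
  have "\<exists>Bs. reformulation As Bs \<and> n \<le> length Bs \<and> length Bs = length As \<and> take n Bs = take n Ms \<and>
      span (set Bs) = span (set As)" if "n \<le> length Ms" for n
    using that
  proof (induction n)
    case 0
    then show ?case by (auto simp: reformulation_def)
  next
    case (Suc n)
    then obtain Bs where Bs: "reformulation As Bs" "n \<le> length Bs" "length Bs = length As"
      "take n Bs = take n Ms" "span (set Bs) = span (set As)" by auto
    have n: "n < length Ms" using Suc by simp
    have "2 \<le> length Bs" using len Bs(3) by simp
    moreover have "Ms ! n \<in> span (set Bs)" using n sp Bs(5) nth_mem by blast
    moreover have "Ms ! n \<notin> span (set (take n Bs))" using ind[OF n] Bs(4) by simp
    ultimately obtain Cs where Cs: "reformulation Bs Cs" "take n Cs = take n Bs" "n < length Cs"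
      "Cs ! n = Ms ! n" "span (set Cs) = span (set Bs)"
      by (rule reformulation_insert)
    have "length Cs = length Bs"
      using Cs(1) unfolding reformulation_def
      by (induction rule: rtranclp_induct) (auto elim: reformulation_step.cases)
    moreover have "take (Suc n) Cs = take (Suc n) Ms"
      using Cs(2-4) Bs(4) n by (simp only: take_Suc_conv_app_nth)
    moreover have "reformulation As Cs" using Bs(1) Cs(1) by (rule reformulation_trans)
    ultimately show ?case using Cs(3,5) Bs(3,5) by (intro exI[of _ Cs]) simp
  qed
  from this[OF order.refl] obtain Bs where Bs: "reformulation As Bs" "length Ms \<le> length Bs"
    "take (length Ms) Bs = take (length Ms) Ms" "span (set Bs) = span (set As)" by blast
  show ?thesis using Bs by (intro that[of Bs]) simp_all
qed

section \<open>Facial reduction\<close>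

text \<open>Closedness of the sum of \<open>C\<close> and \<open>S\<close> is not assumed, so only
  weak separation is available. Taking \<open>a\<close> in the span of the translated sum
  \<open>D\<close> excludes a functional that vanishes on all of it, and this yields the last
  alternative.\<close>

lemma conic_separation:
  fixes C S :: "'a::euclidean_space set"
  assumes C: "convex_cone C" and S: "subspace S" and x: "\<And>c s. c \<in> C \<Longrightarrow> s \<in> S \<Longrightarrow> x \<noteq> c + s"
  obtains a where "a \<in> span (insert x (C \<union> S))" "\<And>s. s \<in> S \<Longrightarrow> a \<bullet> s = 0"
    "\<And>c. c \<in> C \<Longrightarrow> 0 \<le> a \<bullet> c" "a \<bullet> x \<le> 0" "a \<bullet> x < 0 \<or> (\<exists>c\<in>C. 0 < a \<bullet> c)"
proof -
  define D where "D = (\<lambda>y. y - x) ` (\<Union>c\<in>C. \<Union>s\<in>S. {c + s})"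
  have D: "c + s - x \<in> D" if "c \<in> C" "s \<in> S" for c s using that by (auto simp: D_def)
  have C0: "0 \<in> C" using C by (rule convex_cone_contains_0)
  have S0: "0 \<in> S" using S by (rule subspace_0)
  have "convex D"
    unfolding D_def using C S
    by (intro convex_translation_subtract convex_sums) (auto simp: convex_cone_def subspace_imp_convex)
  moreover have "D \<noteq> {}" using D[OF C0 S0] by blast
  moreover have "0 \<notin> D" using x by (force simp: D_def)
  ultimately obtain a where a: "a \<in> span D" "a \<noteq> 0" "\<And>d. d \<in> D \<Longrightarrow> 0 \<le> a \<bullet> d"
    using separating_hyperplane_set_0_inspan[of D] by metis
  have bound: "a \<bullet> x \<le> a \<bullet> c + a \<bullet> s" if "c \<in> C" "s \<in> S" for c s
    using a(3)[OF D[OF that]] by (simp add: inner_diff_right inner_add_right)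
  have aS: "a \<bullet> s = 0" if s: "s \<in> S" for s
  proof (rule ccontr)
    assume nz: "a \<bullet> s \<noteq> 0"
    \<comment> \<open>The multiple of \<open>s\<close> is scaled to have value
      \<open>a \<bullet> x - 1\<close>, which violates the bound; the argument for \<open>c\<close>
      below does the same with a nonnegative factor.\<close>
    have "a \<bullet> x \<le> a \<bullet> 0 + a \<bullet> (((a \<bullet> x - 1) / (a \<bullet> s)) *\<^sub>R s)"
      using s S by (intro bound C0) (simp add: subspace_scale)
    then show False using nz by simp
  qed
  have aC: "0 \<le> a \<bullet> c" if c: "c \<in> C" for c
  proof (rule ccontr)
    assume neg: "\<not> 0 \<le> a \<bullet> c"
    define t where "t = (\<bar>a \<bullet> x\<bar> + 1) / - (a \<bullet> c)"
    have "0 \<le> t" using neg by (simp add: t_def field_simps)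
    then have "a \<bullet> x \<le> a \<bullet> (t *\<^sub>R c) + a \<bullet> 0"
      using c C by (intro bound S0) (simp add: convex_cone_scaleR)
    moreover have "a \<bullet> (t *\<^sub>R c) = - (\<bar>a \<bullet> x\<bar> + 1)" using neg by (simp add: t_def)
    ultimately show False by simp
  qed
  have "D \<subseteq> span (insert x (C \<union> S))"
    by (auto simp: D_def intro: span_diff span_add span_base)
  then have "span D \<subseteq> span (insert x (C \<union> S))" by (metis span_mono span_span)
  moreover have ax: "a \<bullet> x \<le> 0" using bound[OF C0 S0] by simp
  moreover have "a \<bullet> x < 0 \<or> (\<exists>c\<in>C. 0 < a \<bullet> c)"
  proof (rule ccontr)
    assume "\<not> (a \<bullet> x < 0 \<or> (\<exists>c\<in>C. 0 < a \<bullet> c))"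
    then have "a \<bullet> x = 0" "\<And>c. c \<in> C \<Longrightarrow> a \<bullet> c = 0" using ax aC by (force intro: antisym)+
    then have "orthogonal a d" if "d \<in> D" for d
      using that aS by (auto simp: D_def orthogonal_def inner_diff_right inner_add_right)
    then have "orthogonal a a" using orthogonal_to_span[OF a(1)] by blast
    then show False using a(2) by (simp add: orthogonal_def)
  qed
  ultimately show ?thesis using that a(1) aS aC by blast
qed

text \<open>The cone is generated by the matrices \<open>outer v\<close> with
  \<open>v \<in> V\<close>, so nonnegativity on it is nonnegativity of the form on \<open>V\<close>.
  It lies in \<open>psd_cone\<close>, so \<open>X0\<close> is outside its sum with the null
  space.\<close>

lemma facial_reduction_step:
  fixes As :: "(real^'n^'n) list"
  assumes As: "set As \<subseteq> sym_matrices" and X0: "X0 \<in> sym_matrices" "X0 \<notin> psd_plus_null As"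
  obtains M where "M \<in> span (set As)" "\<And>v. v \<in> V \<Longrightarrow> 0 \<le> bform M v v"
    "M \<bullet> X0 < 0 \<or> (M \<bullet> X0 = 0 \<and> (\<exists>v\<in>V. 0 < bform M v v))"
proof -
  let ?C = "convex_cone hull (outer ` V)"
  have Cpsd: "?C \<subseteq> psd_cone"
    using outer_psd convex_cone_psd_cone by (intro hull_minimal) auto
  obtain M where M: "M \<in> span (insert X0 (?C \<union> null_space As))" "\<And>Y. Y \<in> null_space As \<Longrightarrow> M \<bullet> Y = 0"
    "\<And>P. P \<in> ?C \<Longrightarrow> 0 \<le> M \<bullet> P" "M \<bullet> X0 \<le> 0" "M \<bullet> X0 < 0 \<or> (\<exists>P\<in>?C. 0 < M \<bullet> P)"
  proof (rule conic_separation[OF convex_cone_convex_cone_hull subspace_null_space])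
    show "X0 \<noteq> P + Y" if "P \<in> ?C" "Y \<in> null_space As" for P Y
      using X0(2) that Cpsd unfolding psd_plus_null_def by blast
  qed blast
  have "insert X0 (?C \<union> null_space As) \<subseteq> sym_matrices"
    using X0(1) Cpsd psd_sym by (auto simp: null_space_def)
  then have "span (insert X0 (?C \<union> null_space As)) \<subseteq> sym_matrices"
    using subspace_sym_matrices by (intro span_minimal)
  then have Msym: "M \<in> sym_matrices" using M(1) by blast
  show ?thesis
  proof
    \<comment> \<open>The part \<open>Z\<close> of \<open>M\<close> orthogonal to the span is
      symmetric, hence itself in the null space on which \<open>M\<close> vanishes, and therefore
      zero. Symmetry of \<open>M\<close> is known from the span condition in
      \<open>conic_separation\<close>.\<close>
    obtain Y Z where YZ: "Y \<in> span (set As)" "\<And>W. W \<in> span (set As) \<Longrightarrow> orthogonal Z W" "M = Y + Z"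
      using orthogonal_subspace_decomp_exists[of "set As" M] by metis
    have "span (set As) \<subseteq> sym_matrices" using As subspace_sym_matrices by (intro span_minimal)
    then have "Y \<in> sym_matrices" using YZ(1) by blast
    then have Zsym: "Z \<in> sym_matrices"
      using subspace_diff[OF subspace_sym_matrices Msym, of Y] YZ(3) by simp
    have "A \<bullet>\<^sub>M Z = 0" if "A \<in> set As" for A
      using YZ(2)[OF span_base[OF that]] that As
      by (simp add: mat_inner_eq_inner subsetD orthogonal_def inner_commute)
    then have "Z \<in> null_space As" using Zsym by (simp add: null_space_def)
    then have "Y \<bullet> Z + Z \<bullet> Z = 0" using M(2) YZ(3) by (simp add: inner_add_left)
    moreover have "Y \<bullet> Z = 0" using YZ(2)[OF YZ(1)] by (simp add: orthogonal_def inner_commute)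
    ultimately have "Z = 0" by simp
    then show "M \<in> span (set As)" using YZ by simp
  next
    fix v assume "v \<in> V"
    then have "outer v \<in> ?C" by (intro hull_inc) simp
    then show "0 \<le> bform M v v" using M(3)[of "outer v"] by (simp add: inner_outer)
  next
    have "\<exists>v\<in>V. 0 < bform M v v" if P: "P \<in> ?C" "0 < M \<bullet> P" for P
    proof (rule ccontr)
      assume "\<not> (\<exists>v\<in>V. 0 < bform M v v)"
      then have "outer ` V \<subseteq> {P. M \<bullet> P \<le> 0}" by (auto simp: inner_outer not_less)
      then have "?C \<subseteq> {P. M \<bullet> P \<le> 0}" by (intro hull_minimal convex_cone_halfspace_le)
      with P show False by auto
    qed
    then show "M \<bullet> X0 < 0 \<or> (M \<bullet> X0 = 0 \<and> (\<exists>v\<in>V. 0 < bform M v v))"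
      using M(4,5) by force
  qed
qed

section \<open>The sequence of forms in the span\<close>

lemma bform_zero_on_span:
  assumes "\<And>M. M \<in> S \<Longrightarrow> bform M v v = 0" "N \<in> span S"
  shows "bform N v v = 0"
proof -
  have "linear (\<lambda>M. bform M v v)" by (rule linearI) (simp_all add: bform_add_matrix bform_scaleR_matrix)
  then show ?thesis using linear_eq_0_on_span assms by blast
qed

lemma inner_zero_on_span:
  fixes x :: "'a::real_inner"
  assumes "\<And>y. y \<in> S \<Longrightarrow> y \<bullet> x = 0" "z \<in> span S"
  shows "z \<bullet> x = 0"
proof -
  have "linear (\<lambda>y. y \<bullet> x)" by (rule linearI) (simp_all add: inner_add_left)
  then show ?thesis using linear_eq_0_on_span assms by blast
qed

lemma dim_flag_snoc_less:
  assumes reg: "regular (Ms @ [M])" and v: "v \<in> flag Ms (length Ms)" "bform M v v \<noteq> 0"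
  shows "dim (flag (Ms @ [M]) (length (Ms @ [M]))) < dim (flag Ms (length Ms))"
proof -
  let ?U = "flag (Ms @ [M]) (length (Ms @ [M]))" and ?V = "flag Ms (length Ms)"
  have U: "?U = {v \<in> ?V. bform M v v = 0}" by (simp add: flag_Suc flag_append)
  have "subspace ?U" "subspace ?V" using reg by (auto intro!: subspace_flag simp: regular_snoc)
  moreover have "?U \<subseteq> ?V" "?U \<noteq> ?V" using v unfolding U by auto
  ultimately show ?thesis using subspace_dim_equal[of ?U ?V] by (metis not_le)
qed

text \<open>The independence clause is what \<open>reformulation_prefix\<close> needs to bring the
  rows to the front of the list.\<close>

definition echelon_rows :: "(real^'n^'n) list \<Rightarrow> (real^'n^'n) list \<Rightarrow> bool" where
  "echelon_rows As Ms \<longleftrightarrow> regular Ms \<and> set Ms \<subseteq> span (set As) \<and>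
     (\<forall>i<length Ms. Ms ! i \<notin> span (set (take i Ms)))"

lemma echelon_rows_snoc:
  "echelon_rows As (Ms @ [M]) \<longleftrightarrow> echelon_rows As Ms \<and> M \<in> span (set As) \<and> M \<notin> span (set Ms) \<and>
     M \<in> sym_matrices \<and> (\<forall>v\<in>flag Ms (length Ms). 0 \<le> bform M v v)"
  by (auto simp: echelon_rows_def regular_snoc nth_append less_Suc_eq)

text \<open>Facial reduction is repeated on the last flag member, whose dimension drops as long as
  the value at \<open>X0\<close> is 0. Independence is witnessed by a point where all earlier rows
  vanish and the new one does not: the vector \<open>v\<close>, or at the end \<open>X0\<close>
  itself.\<close>

lemma ex_infeasibility_rows:
  fixes As :: "(real^'n^'n) list"
  assumes As: "set As \<subseteq> sym_matrices" and X0: "X0 \<in> sym_matrices" "X0 \<notin> psd_plus_null As"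
  obtains Ms M where "echelon_rows As (Ms @ [M])" "\<And>N. N \<in> set Ms \<Longrightarrow> N \<bullet> X0 = 0" "M \<bullet> X0 = -1"
proof -
  have span_sym: "span (set As) \<subseteq> sym_matrices"
    using As subspace_sym_matrices by (intro span_minimal)
  have "\<exists>Ms M. echelon_rows As (Ms @ [M]) \<and> (\<forall>N\<in>set Ms. N \<bullet> X0 = 0) \<and> M \<bullet> X0 = -1"
    if "echelon_rows As Ns" "\<forall>N\<in>set Ns. N \<bullet> X0 = 0" for Ns
    using that
  proof (induction "dim (flag Ns (length Ns))" arbitrary: Ns rule: less_induct)
    case less
    obtain M where M: "M \<in> span (set As)" "\<And>v. v \<in> flag Ns (length Ns) \<Longrightarrow> 0 \<le> bform M v v"
      "M \<bullet> X0 < 0 \<or> (M \<bullet> X0 = 0 \<and> (\<exists>v\<in>flag Ns (length Ns). 0 < bform M v v))"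
      using facial_reduction_step[OF As X0, of "flag Ns (length Ns)"] by blast
    from M(3) show ?case
    proof
      assume neg: "M \<bullet> X0 < 0"
      define M' where "M' = (1 / - (M \<bullet> X0)) *\<^sub>R M"
      have M'X0: "M' \<bullet> X0 = -1" using neg by (simp add: M'_def)
      have M': "M' \<in> span (set As)" unfolding M'_def by (rule span_scale[OF M(1)])
      have "M' \<notin> span (set Ns)"
        using inner_zero_on_span[of "set Ns" X0 M'] less.prems(2) M'X0 by auto
      moreover have "0 \<le> bform M' v v" if "v \<in> flag Ns (length Ns)" for v
      proof -
        have "bform M' v v = (1 / - (M \<bullet> X0)) * bform M v v" unfolding M'_def by (rule bform_scaleR_matrix)
        moreover have "0 \<le> 1 / - (M \<bullet> X0)" using neg by simp
        ultimately show ?thesis using M(2)[OF that] by (metis mult_nonneg_nonneg)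
      qed
      ultimately have "echelon_rows As (Ns @ [M'])"
        using less.prems(1) M' span_sym by (auto simp: echelon_rows_snoc)
      with less.prems(2) M'X0 show ?thesis by blast
    next
      assume "M \<bullet> X0 = 0 \<and> (\<exists>v\<in>flag Ns (length Ns). 0 < bform M v v)"
      then obtain v where v: "M \<bullet> X0 = 0" "v \<in> flag Ns (length Ns)" "0 < bform M v v" by blast
      have "bform N v v = 0" if "N \<in> set Ns" for N
        using v(2) that by (auto simp: flag_def in_set_conv_nth)
      then have "M \<notin> span (set Ns)" using bform_zero_on_span[of "set Ns" v M] v(3) by auto
      then have ech: "echelon_rows As (Ns @ [M])"
        using less.prems(1) M(1,2) span_sym by (auto simp: echelon_rows_snoc)
      then have "dim (flag (Ns @ [M]) (length (Ns @ [M]))) < dim (flag Ns (length Ns))"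
        using v by (intro dim_flag_snoc_less[where v = v]) (auto simp: echelon_rows_def)
      then show ?thesis using less.hyps[of "Ns @ [M]"] ech less.prems(2) v(1) by auto
    qed
  qed
  from this[of "[]"] that show ?thesis by (auto simp: echelon_rows_def regular_def)
qed

text \<open>By compactness, unit vectors of \<open>C\<close> stay at distance at least
  \<open>d\<close> from \<open>S\<close>, so \<open>d * norm x \<le> norm (x + y)\<close>. Near a
  given point only a bounded part of \<open>C\<close> contributes, and a compact set plus a closed
  set is closed.\<close>

lemma closed_cone_plus_subspace:
  fixes C S :: "'a::euclidean_space set"
  assumes C: "closed C" "\<And>x c. x \<in> C \<Longrightarrow> 0 \<le> c \<Longrightarrow> c *\<^sub>R x \<in> C" and S: "subspace S" and "C \<inter> S \<subseteq> {0}"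
  shows "closed (\<Union>x\<in>C. \<Union>y\<in>S. {x + y})"
proof -
  let ?K = "\<lambda>A. \<Union>x\<in>A. \<Union>y\<in>S. {x + y}"
  have clS: "closed S" "S \<noteq> {}" using S closed_subspace subspace_0 by blast+
  have "\<exists>d>0. \<forall>x\<in>C \<inter> sphere 0 1. d \<le> infdist x S"
  proof (cases "C \<inter> sphere 0 1 = {}")
    case False
    have "compact (C \<inter> sphere 0 1)" using C(1) by (simp add: closed_Int_compact)
    moreover have "continuous_on (C \<inter> sphere 0 1) (\<lambda>x. infdist x S)" by (intro continuous_intros)
    ultimately obtain p where p: "p \<in> C \<inter> sphere 0 1" "\<And>x. x \<in> C \<inter> sphere 0 1 \<Longrightarrow> infdist p S \<le> infdist x S"
      using continuous_attains_inf[OF _ False, of "\<lambda>x. infdist x S"] by blast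
    have "p \<notin> S" using p(1) assms(4) by auto
    then have "0 < infdist p S" using clS by (metis in_closed_iff_infdist_zero infdist_nonneg order_le_less)
    with p show ?thesis by blast
  qed (auto intro: exI[of _ 1])
  then obtain d where d: "0 < d" "\<And>x. x \<in> C \<Longrightarrow> norm x = 1 \<Longrightarrow> d \<le> infdist x S" by auto
  have low: "d * norm x \<le> norm (x + y)" if x: "x \<in> C" and y: "y \<in> S" for x y
  proof (cases "x = 0")
    case False
    define u where "u = (1 / norm x) *\<^sub>R x"
    define w where "w = (- 1 / norm x) *\<^sub>R y"
    have "u \<in> C" "norm u = 1" "w \<in> S" using x y C(2) S False by (auto simp: u_def w_def subspace_scale subspace_neg)
    then have "d \<le> dist u w" using d(2)[of u] infdist_le[of w S u] by linarith
    also have "dist u w = norm (x + y) / norm x"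
      using False by (simp add: u_def w_def dist_norm flip: scaleR_add_right)
    finally show ?thesis using False by (simp add: pos_le_divide_eq)
  qed simp
  have "z \<in> ?K C" if z: "z \<in> closure (?K C)" for z
  proof -
    \<comment> \<open>Elements of the sum in the unit ball around \<open>z\<close> have norm at most
      \<open>norm z + 1\<close>, which bounds their part in \<open>C\<close> by
      \<open>R\<close>.\<close>
    define R where "R = (norm z + 1) / d"
    have "z \<in> ball z 1 \<inter> closure (?K C)" using z by simp
    also have "\<dots> \<subseteq> closure (ball z 1 \<inter> ?K C)" by (rule open_Int_closure_subset) simp
    also have "\<dots> \<subseteq> closure (?K (C \<inter> cball 0 R))"
    proof (intro closure_mono subsetI)
      fix u assume u: "u \<in> ball z 1 \<inter> ?K C"
      then obtain x y where xy: "x \<in> C" "y \<in> S" "u = x + y" by auto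
      have "norm u \<le> norm z + 1" using u norm_triangle_ineq2[of u z] by (auto simp: dist_norm norm_minus_commute)
      then have "d * norm x \<le> norm z + 1" using low[OF xy(1,2)] xy(3) by simp
      then have "norm x \<le> R" using d(1) by (simp add: R_def pos_le_divide_eq mult.commute)
      then show "u \<in> ?K (C \<inter> cball 0 R)" using xy by auto
    qed
    also have "\<dots> = ?K (C \<inter> cball 0 R)"
      using C(1) clS(1) by (intro closure_closed compact_closed_sums) (auto simp: closed_Int_compact)
    finally show ?thesis by auto
  qed
  then show ?thesis using closure_subset_eq by blast
qed

lemma closed_psd_cone: "closed (psd_cone :: (real^'n^'n) set)"
proof -
  have eq: "(psd_cone :: (real^'n^'n) set) = sym_matrices \<inter> (\<Inter>v. {X. 0 \<le> X \<bullet> outer v})"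
    by (auto simp: psd_cone_def inner_outer)
  show ?thesis
    unfolding eq
    by (intro closed_Int closed_sym_matrices closed_INT ballI closed_Collect_le continuous_intros)
qed

text \<open>If the null space contains no matrix that is semidefinite and nonzero on \<open>W\<close>, then
  semidefinite matrices plus null space is closed after restriction of the forms to \<open>W\<close>.\<close>

lemma dual_facial_reduction_step:
  fixes As :: "(real^'n^'n) list"
  assumes W: "subspace W" and X0: "X0 \<in> closure (psd_plus_null As)"
    and none: "\<And>Y. Y \<in> null_space As \<Longrightarrow> (\<And>v. v \<in> W \<Longrightarrow> 0 \<le> bform Y v v) \<Longrightarrow> (\<And>v. v \<in> W \<Longrightarrow> bform Y v v = 0)"
  obtains Z where "Z - X0 \<in> null_space As" "\<And>v. v \<in> W \<Longrightarrow> 0 \<le> bform Z v v"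
proof -
  have "linear (id :: real^'n \<Rightarrow> real^'n)" by (rule linear_id)
  \<comment> \<open>\<open>g\<close> projects onto \<open>W\<close>, and \<open>\<rho>\<close>
    restricts a form to \<open>W\<close> and pulls it back along \<open>g\<close>; restriction thus
    stays within matrices of the same size and preserves semidefiniteness.\<close>
  then obtain g :: "real^'n \<Rightarrow> real^'n" where g: "range g \<subseteq> W" "linear g" "\<And>v. v \<in> W \<Longrightarrow> g v = v"
    using linear_exists_left_inverse_on[of id W] W by auto
  define R where "R = matrix g"
  have R: "R *v v = g v" for v unfolding R_def using g(2) by (simp add: matrix_works)
  define \<rho> where "\<rho> X = transpose R ** X ** R" for X
  have lin: "linear \<rho>" unfolding \<rho>_def by (rule linear_transform)
  have form: "bform (\<rho> X) v v = bform X (g v) (g v)" for X v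
    unfolding \<rho>_def bform_transform R ..
  have formW: "bform (\<rho> X) v v = bform X v v" if "v \<in> W" for X v
    using form g(3)[OF that] by simp
  have "psd_cone \<inter> \<rho> ` null_space As \<subseteq> {0}"
  proof
    fix Q assume "Q \<in> psd_cone \<inter> \<rho> ` null_space As"
    then obtain Y where Y: "Q \<in> psd_cone" "Y \<in> null_space As" "Q = \<rho> Y" by blast
    have Q: "Q \<in> sym_matrices" "\<And>v. 0 \<le> bform Q v v" using Y(1) by (auto simp: psd_cone_def)
    have "0 \<le> bform Y v v" if "v \<in> W" for v using Q(2)[of v] formW[OF that, of Y] Y(3) by simp
    then have "bform Y (g v) (g v) = 0" for v using none[OF Y(2)] g(1) by blast
    then have "bform Q v v = 0" for v using form Y(3) by simp
    then have "bform Q u v = 0" for u v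
      using bform_kernel[OF Q(1) subspace_UNIV, of u v] by simp
    then have "Q $ a $ b = 0" for a b using bform_axis[where M = Q and a = a and b = b] by simp
    then show "Q \<in> {0}" by (simp add: vec_eq_iff)
  qed
  then have cl: "closed (\<Union>P\<in>psd_cone. \<Union>Y\<in>\<rho> ` null_space As. {P + Y})"
    by (intro closed_cone_plus_subspace closed_psd_cone psd_cone_scaleR linear_subspace_image[OF lin] subspace_null_space)
  have "\<rho> X0 \<in> closure (\<rho> ` psd_plus_null As)"
    using closure_linear_image_subset[OF lin] X0 by blast
  also have "\<dots> \<subseteq> closure (\<Union>P\<in>psd_cone. \<Union>Y\<in>\<rho> ` null_space As. {P + Y})"
  proof (intro closure_mono subsetI)
    fix Q assume "Q \<in> \<rho> ` psd_plus_null As"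
    then obtain P Y where PY: "Q = \<rho> (P + Y)" "P \<in> psd_cone" "Y \<in> null_space As"
      by (auto simp: psd_plus_null_def)
    have "\<rho> P \<in> psd_cone" using PY(2) unfolding \<rho>_def by (rule psd_cone_transform)
    then show "Q \<in> (\<Union>P\<in>psd_cone. \<Union>Y\<in>\<rho> ` null_space As. {P + Y})"
      using PY linear_add[OF lin] by auto
  qed
  finally obtain P Y where PY: "P \<in> psd_cone" "Y \<in> null_space As" "\<rho> X0 = P + \<rho> Y"
    using cl by (auto simp: closure_closed)
  show ?thesis
  proof
    show "X0 - Y - X0 \<in> null_space As"
      using subspace_neg[OF subspace_null_space PY(2)] by simp
    have "\<rho> (X0 - Y) = P" using PY(3) linear_diff[OF lin] by simp
    then show "0 \<le> bform (X0 - Y) v v" if "v \<in> W" for v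
      using formW[OF that, of "X0 - Y"] PY(1) by (metis (no_types, lifting) mem_Collect_eq psd_cone_def)
  qed
qed

text \<open>If some null space matrix is semidefinite and nonzero on the last flag member, it is
  appended and the dimension drops. Otherwise the restricted sum is closed, and a translate
  \<open>Z\<close> of \<open>X0\<close> by the null space that is semidefinite there ends the
  sequence.\<close>

lemma ex_weak_feasibility_sequence:
  fixes As :: "(real^'n^'n) list"
  assumes X0: "X0 \<in> sym_matrices" "X0 \<in> closure (psd_plus_null As)"
  obtains Ys Z where "regular (Ys @ [Z])" "set Ys \<subseteq> null_space As" "Ys \<noteq> []" "Z - X0 \<in> null_space As"
proof -
  have "\<exists>Ys Z. regular (Ys @ [Z]) \<and> set Ys \<subseteq> null_space As \<and> Ys \<noteq> [] \<and> Z - X0 \<in> null_space As"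
    if "regular Xs" "set Xs \<subseteq> null_space As" "Xs \<noteq> []" for Xs
    using that
  proof (induction "dim (flag Xs (length Xs))" arbitrary: Xs rule: less_induct)
    case less
    let ?W = "flag Xs (length Xs)"
    show ?case
    proof (cases "\<exists>Y\<in>null_space As. (\<forall>v\<in>?W. 0 \<le> bform Y v v) \<and> (\<exists>v\<in>?W. bform Y v v \<noteq> 0)")
      case True
      then obtain Y v where Y: "Y \<in> null_space As" "\<forall>v\<in>?W. 0 \<le> bform Y v v" "v \<in> ?W" "bform Y v v \<noteq> 0"
        by blast
      have reg: "regular (Xs @ [Y])" using less.prems(1) Y by (auto simp: regular_snoc null_space_def)
      have "dim (flag (Xs @ [Y]) (length (Xs @ [Y]))) < dim ?W"
        using reg Y(3,4) by (rule dim_flag_snoc_less)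
      then show ?thesis using less.hyps[of "Xs @ [Y]"] reg less.prems Y(1) by auto
    next
      case False
      obtain Z where Z: "Z - X0 \<in> null_space As" "\<And>v. v \<in> ?W \<Longrightarrow> 0 \<le> bform Z v v"
      proof (rule dual_facial_reduction_step[OF _ X0(2), of ?W])
        show "subspace ?W" using less.prems(1) by (intro subspace_flag) auto
        show "bform Y v v = 0" if "Y \<in> null_space As" "\<And>v. v \<in> ?W \<Longrightarrow> 0 \<le> bform Y v v" "v \<in> ?W" for Y v
          using False that by blast
      qed blast
      have "Z \<in> sym_matrices"
        using subspace_add[OF subspace_sym_matrices, of "Z - X0" X0] Z(1) X0(1) by (simp add: null_space_def)
      then have "regular (Xs @ [Z])" using less.prems(1) Z(2) by (simp add: regular_snoc)
      with less.prems Z(1) show ?thesis by blast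
    qed
  qed
  moreover have "regular [0 :: real^'n^'n]"
    using subspace_0[OF subspace_sym_matrices] by (auto simp: regular_def)
  moreover have "set [0] \<subseteq> null_space As" using subspace_0[OF subspace_null_space] by simp
  ultimately show ?thesis using that by blast
qed

text \<open>\<open>Xs ! l\<close> is in the closure of \<open>K\<close>, since every perturbation by
  a positive multiple of the identity becomes semidefinite after adding a null space matrix. If
  \<open>K\<close> were closed, some semidefinite \<open>P\<close> would have the same image, and
  the first sequence forbids a negative value at position \<open>k\<close>.\<close>

lemma not_closed_psd_plus_null:
  fixes Bs Xs :: "(real^'n^'n) list"
  assumes Bs: "set Bs \<subseteq> sym_matrices" and k: "k < length Bs" and ech: "sd_echelon (take (k + 1) Bs)"
    and Xs: "sd_echelon Xs" and l: "l < length Xs"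
    and null: "\<And>B j. B \<in> set Bs \<Longrightarrow> j < l \<Longrightarrow> B \<bullet>\<^sub>M Xs ! j = 0"
    and zero: "\<And>i. i < k \<Longrightarrow> Bs ! i \<bullet>\<^sub>M Xs ! l = 0" and neg: "Bs ! k \<bullet>\<^sub>M Xs ! l < 0"
  shows "\<not> closed (psd_plus_null Bs)"
proof
  assume cl: "closed (psd_plus_null Bs)"
  have regX: "regular Xs" using Xs by (rule regular_of_sd_echelon)
  have regB: "regular (take (k + 1) Bs)" using ech by (rule regular_of_sd_echelon)
  have sym: "Bs ! i \<in> sym_matrices" if "i \<le> k" for i using Bs that k nth_mem[of i Bs] by auto
  have "set (take l Xs) \<subseteq> null_space Bs"
  proof
    fix Y assume "Y \<in> set (take l Xs)"
    then obtain j where j: "j < l" "Y = Xs ! j" using l by (auto simp: in_set_conv_nth)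
    then show "Y \<in> null_space Bs"
      using null[OF _ j(1)] regular_sym[OF regX, of j] l by (simp add: null_space_def)
  qed
  then have spn: "span (set (take l Xs)) \<subseteq> null_space Bs"
    using subspace_null_space by (intro span_minimal)
  have "Xs ! l + (1 / real (Suc n)) *\<^sub>R mat 1 \<in> psd_plus_null Bs" for n
  proof -
    obtain Y where Y: "Y \<in> span (set (take l Xs))" "Xs ! l + (1 / real (Suc n)) *\<^sub>R mat 1 + Y \<in> psd_cone"
      by (rule regular_positive_combination[OF regX l, of "1 / real (Suc n)"]) simp
    have "- Y \<in> null_space Bs" using spn Y(1) subspace_neg[OF subspace_null_space] by blast
    moreover have "Xs ! l + (1 / real (Suc n)) *\<^sub>R mat 1 = (Xs ! l + (1 / real (Suc n)) *\<^sub>R mat 1 + Y) + - Y" by simp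
    ultimately show ?thesis using Y(2) unfolding psd_plus_null_def by blast
  qed
  moreover have "(\<lambda>n. Xs ! l + (1 / real (Suc n)) *\<^sub>R mat 1) \<longlonglongrightarrow> Xs ! l + 0 *\<^sub>R mat 1"
    by (intro tendsto_intros LIMSEQ_Suc lim_1_over_n)
  ultimately have "Xs ! l \<in> psd_plus_null Bs"
    using closed_sequentially[OF cl, of "\<lambda>n. Xs ! l + (1 / real (Suc n)) *\<^sub>R mat 1" "Xs ! l"] by simp
  then obtain P where P: "P \<in> psd_cone" "rep_map Bs (Xs ! l) = rep_map Bs P"
    unfolding psd_plus_null_iff by blast
  have "Bs ! i \<bullet>\<^sub>M Xs ! l = Bs ! i \<bullet> P" if "i \<le> k" for i
  proof -
    have "Bs ! i \<in> set Bs" using that k by simp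
    then have "Bs ! i \<bullet>\<^sub>M Xs ! l = Bs ! i \<bullet>\<^sub>M P" using P(2) unfolding rep_map_eq_iff by blast
    then show ?thesis using mat_inner_eq_inner[OF sym[OF that]] by simp
  qed
  then have "0 \<le> Bs ! k \<bullet>\<^sub>M Xs ! l"
    using regular_inner_psd_nonneg[OF regB _ P(1), of k] k zero by simp
  with neg show False by simp
qed

theorem corollary1:
  fixes As :: "(real^'n^'n) list" and m :: nat
  assumes "length As = m" and "set As \<subseteq> sym_matrices"
  shows "\<not> closedin (Euclidean_space m) (rep_map As ` psd_cone) \<longleftrightarrow>
    (\<exists>Bs. reformulation As Bs \<and>
      (\<exists>k \<ge> 1. k + 1 \<le> m \<and> sd_echelon (take (k + 1) Bs) \<and>
        (\<exists>l \<ge> 1. \<exists>Xs. length Xs = l + 1 \<and> sd_echelon Xs \<and>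
          (\<forall>i < m. \<forall>j < l. Bs ! i \<bullet>\<^sub>M Xs ! j = 0) \<and>
          (\<forall>i < k. Bs ! i \<bullet>\<^sub>M Xs ! l = 0) \<and>
          Bs ! k \<bullet>\<^sub>M Xs ! l = -1)))"
  (is "?L \<longleftrightarrow> ?R")
proof
  assume ?R
  then obtain Bs k l Xs where B: "reformulation As Bs" "k + 1 \<le> m" "sd_echelon (take (k + 1) Bs)"
    and X: "length Xs = l + 1" "sd_echelon Xs" "\<forall>i < m. \<forall>j < l. Bs ! i \<bullet>\<^sub>M Xs ! j = 0"
      "\<forall>i < k. Bs ! i \<bullet>\<^sub>M Xs ! l = 0" "Bs ! k \<bullet>\<^sub>M Xs ! l = -1" by blast
  note inv = reformulation_invariant[OF B(1) assms(2)]
  have "\<not> closed (psd_plus_null Bs)"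
    using inv B X assms(1) by (intro not_closed_psd_plus_null[of Bs k Xs l]) (auto simp: in_set_conv_nth)
  then show ?L using inv closedin_rep_map_iff[OF assms(2)] assms(1) by simp
next
  assume ?L
  then have "\<not> closed (psd_plus_null As)" using closedin_rep_map_iff[OF assms(2)] assms(1) by simp
  then obtain X0 where X0: "X0 \<in> closure (psd_plus_null As)" "X0 \<notin> psd_plus_null As"
    using closure_subset_eq by blast
  have "closure (psd_plus_null As) \<subseteq> sym_matrices"
    using psd_plus_null_sym closed_sym_matrices by (intro closure_minimal) auto
  then have sym0: "X0 \<in> sym_matrices" using X0(1) by blast
  obtain Ms M where M: "echelon_rows As (Ms @ [M])" "\<And>N. N \<in> set Ms \<Longrightarrow> N \<bullet> X0 = 0" "M \<bullet> X0 = -1"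
    using ex_infeasibility_rows[OF assms(2) sym0 X0(2)] by blast
  obtain Ys Z where Y: "regular (Ys @ [Z])" "set Ys \<subseteq> null_space As" "Ys \<noteq> []" "Z - X0 \<in> null_space As"
    using ex_weak_feasibility_sequence[OF sym0 X0(1)] by blast
  have span_sym: "span (set As) \<subseteq> sym_matrices"
    using assms(2) subspace_sym_matrices by (intro span_minimal)
  have Msp: "set (Ms @ [M]) \<subseteq> span (set As)" and regM: "regular (Ms @ [M])"
    and ind: "\<And>i. i < length (Ms @ [M]) \<Longrightarrow> (Ms @ [M]) ! i \<notin> span (set (take i (Ms @ [M])))"
    using M(1) unfolding echelon_rows_def by blast+
  \<comment> \<open>If \<open>M\<close> were the only row, it would be semidefinite everywhere, and
    the closed half-space it defines would contain \<open>K\<close> and with it \<open>X0\<close>,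
    against the value -1.\<close>
  have "Ms \<noteq> []"
  proof
    assume "Ms = []"
    then have psd: "0 \<le> bform M v v" for v using regM by (simp add: regular_def)
    have "psd_plus_null As \<subseteq> {X. 0 \<le> M \<bullet> X}"
    proof
      fix X assume "X \<in> psd_plus_null As"
      then obtain P Y where PY: "X = P + Y" "P \<in> psd_cone" "Y \<in> null_space As"
        by (auto simp: psd_plus_null_def)
      have "M \<bullet>\<^sub>M Y = 0" using PY(3) Msp unfolding null_space_span by simp
      then have "M \<bullet> Y = 0" using Msp span_sym mat_inner_eq_inner[of M Y] by auto
      then show "X \<in> {X. 0 \<le> M \<bullet> X}" using inner_psd_nonneg[OF psd PY(2)] PY(1) by (simp add: inner_add_right)
    qed
    then have "closure (psd_plus_null As) \<subseteq> {X. 0 \<le> M \<bullet> X}"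
      by (intro closure_minimal closed_halfspace_ge)
    then show False using X0(1) M(3) by auto
  qed
  define k where "k = length Ms"
  define l where "l = length Ys"
  have k: "1 \<le> k" and l: "1 \<le> l" using \<open>Ms \<noteq> []\<close> Y(3) by (auto simp: k_def l_def Suc_le_eq)
  \<comment> \<open>\<open>Ms ! 0\<close> and \<open>M\<close> are independent members of the span,
    so one matrix cannot produce them. Two entries are required because a combination uses two
    indices.\<close>
  have len: "2 \<le> length As"
  proof (rule ccontr)
    assume "\<not> 2 \<le> length As"
    then obtain A where "set As \<subseteq> {A}" by (cases As; cases "tl As") auto
    then have sp: "set (Ms @ [M]) \<subseteq> span {A}" using Msp span_mono by blast
    have "Ms ! 0 \<in> set (Ms @ [M])" using \<open>Ms \<noteq> []\<close> by simp
    then obtain c where c: "Ms ! 0 = c *\<^sub>R A" using sp by (auto simp: span_singleton)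
    obtain d where d: "M = d *\<^sub>R A" using sp by (auto simp: span_singleton)
    have "Ms ! 0 \<noteq> 0" using ind[of 0] \<open>Ms \<noteq> []\<close> by (auto simp: nth_append)
    then have "M = (d / c) *\<^sub>R Ms ! 0" using c d by auto
    moreover have "Ms ! 0 \<in> set Ms" using \<open>Ms \<noteq> []\<close> by simp
    ultimately have "M \<in> span (set Ms)" by (metis span_base span_scale)
    then show False using ind[of "length Ms"] by simp
  qed
  obtain Cs where Cs: "reformulation As Cs" "length (Ms @ [M]) \<le> length Cs"
    "take (length (Ms @ [M])) Cs = Ms @ [M]" "span (set Cs) = span (set As)"
    using reformulation_prefix[OF len Msp ind] by blast
  obtain T S :: "real^'n^'n" where TS: "T ** S = mat 1" "S ** T = mat 1"
    and echM: "sd_echelon (map (\<lambda>M. transpose T ** M ** T) (Ms @ [M]))"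
    and echX: "sd_echelon (map (\<lambda>X. S ** X ** transpose S) (Ys @ [Z]))"
    using simultaneous_sd_echelon[OF regM Y(1)] by blast
  \<comment> \<open>The congruence comes last: it acts on all entries alike, so the prefix arranged
    in \<open>Cs\<close> keeps its position.\<close>
  define Bs where "Bs = map (\<lambda>M. transpose T ** M ** T) Cs"
  define Xs where "Xs = map (\<lambda>X. S ** X ** transpose S) (Ys @ [Z])"
  have lenC: "length Cs = m" using reformulation_invariant[OF Cs(1) assms(2)] assms(1) by simp
  have "invertible T" using TS by (auto simp: invertible_def)
  then have "reformulation As Bs"
    unfolding Bs_def
    by (intro reformulation_trans[OF Cs(1)] reformulation_of_step reformulation_step.congruence)
  moreover have "k + 1 \<le> m" using Cs(2) lenC by (simp add: k_def)
  moreover have takeC: "take (k + 1) Cs = Ms @ [M]" using Cs(3) by (simp add: k_def)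
  then have "sd_echelon (take (k + 1) Bs)" using echM unfolding Bs_def take_map by simp
  moreover have "length Xs = l + 1" by (simp add: Xs_def l_def)
  moreover have "sd_echelon Xs" using echX unfolding Xs_def .
  moreover have entry: "Bs ! i \<bullet>\<^sub>M Xs ! j = Cs ! i \<bullet>\<^sub>M (Ys @ [Z]) ! j" if "i < m" "j \<le> l" for i j
    using that lenC mat_inner_transform[OF TS(1), of "Cs ! i" "(Ys @ [Z]) ! j"]
    by (simp add: Bs_def Xs_def l_def del: map_append)
  have C_null: "Cs ! i \<bullet>\<^sub>M Y = 0" if "i < m" "Y \<in> null_space As" for i Y
  proof -
    have "Cs ! i \<in> span (set As)" using that(1) lenC Cs(4) span_base nth_mem by metis
    then show ?thesis using that(2) unfolding null_space_span by blast
  qed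
  have "Bs ! i \<bullet>\<^sub>M Xs ! j = 0" if "i < m" "j < l" for i j
  proof -
    have "Ys ! j \<in> null_space As" using that(2) Y(2) nth_mem by (auto simp: l_def)
    then show ?thesis using that entry[of i j] C_null[OF that(1)] by (simp add: nth_append l_def)
  qed
  \<comment> \<open>\<open>Z\<close> differs from \<open>X0\<close> by a null space matrix, so every
    row takes the same value at both.\<close>
  moreover have last: "Bs ! i \<bullet>\<^sub>M Xs ! l = (Ms @ [M]) ! i \<bullet> X0" if "i \<le> k" for i
  proof -
    have i: "i < m" using that \<open>k + 1 \<le> m\<close> by simp
    have Ci: "Cs ! i = (Ms @ [M]) ! i" using takeC that by (metis nth_take less_Suc_eq_le Suc_eq_plus1)
    have "(Ms @ [M]) ! i \<in> set (Ms @ [M])" using that by (intro nth_mem) (simp add: k_def)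
    then have "Cs ! i \<in> sym_matrices" using Msp span_sym Ci by (metis subsetD)
    then have "Cs ! i \<bullet>\<^sub>M X0 = (Ms @ [M]) ! i \<bullet> X0" using Ci mat_inner_eq_inner by metis
    moreover have "Cs ! i \<bullet>\<^sub>M Z = Cs ! i \<bullet>\<^sub>M X0 + Cs ! i \<bullet>\<^sub>M (Z - X0)"
      using mat_inner_add_right[of "Cs ! i" X0 "Z - X0"] by simp
    ultimately show ?thesis using entry[OF i order.refl] C_null[OF i Y(4)] by (simp add: l_def)
  qed
  have "Bs ! i \<bullet>\<^sub>M Xs ! l = 0" if "i < k" for i
    using last[of i] that M(2)[of "Ms ! i"] by (simp add: nth_append k_def)
  moreover have "Bs ! k \<bullet>\<^sub>M Xs ! l = -1" using last[of k] M(3) by (simp add: k_def)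
  ultimately show ?R using k l by blast
qed

end
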